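(* Let $s=(s(1),\dots,s(n))$ be a weak composition. Define the edge labeling $\lambda$ of the Hasse diagram of $s$-weak order by $\lambda(T,Z)=a$ for every cover relation $T\lessdot Z$, where $(a,b)$ is the unique tree ascent of $T$ such that $Z$ is the $s$-tree rotation of $T$ along $(a,b)$. Then $\lambda$ is an SB-labeling of $s$-weak order.
   Context: A weak composition is a sequence $s=(s(1),\dots,s(n))$ of nonnegative integers. An $s$-decreasing tree is a planar rooted tree $T$ whose internal vertices are labeled bijectively by $1,\dots,n$ (leaves are unlabeled), such that internal vertex $i$ has exactly $s(i)+1$ children, indexed $0,1,\dots,s(i)$ from left to right, and every labeled descendant of $i$ has a label smaller than $i$. Write $T^i$ for the full subtree rooted at $i$ and $T^i_j$ for the full subtree rooted at the $j$-th child of $i$; "$x\in T^i_j$" means $x$ is a labeled vertex of that subtree. For $1\le x<y\le n$ the cardinality $\#_T(y,x)$ is: $0$ if $x$ is to the left of $y$ in $T$ or $x\in T^y_0$; $i$ if $x\in T^y_i$ with $0<i<s(y)$; $s(y)$ if $x\in T^y_{s(y)}$ or $x$ is to the right of $y$ in $T$. A multi-inversion set on $[n]$ is a multiset $I$ of pairs $(y,x)$ with $1\le x<y\le n$, with multiplicities $\#_I(y,x)$ ($0$ if absent); $\mathrm{inv}(T)$ is the multi-inversion set with $\#_{\mathrm{inv}(T)}(y,x)=\#_T(y,x)$. For multi-inversion sets, $I\subseteq J$ means $\#_I(y,x)\le \#_J(y,x)$ for all pairs; $I\cup J$ has multiplicities $\max(\#_I,\#_J)$; $I+J$ has multiplicities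 $\min(\#_I(y,x)+\#_J(y,x),s(y))$, and $I+(b,a)$ means $I+\{(b,a)\}$. $I$ is transitive if for all $a<b<c$ with $\#_I(c,b)=i$, either $\#_I(b,a)=0$ or $\#_I(c,a)\ge i$; $I^{tc}$ is the smallest transitive multi-inversion set containing $I$. The $s$-weak order is the partial order on $s$-decreasing trees with $T\preceq Z$ iff $\mathrm{inv}(T)\subseteq \mathrm{inv}(Z)$; it is a finite lattice with $\mathrm{inv}(T\vee Z)=(\mathrm{inv}(T)\cup\mathrm{inv}(Z))^{tc}$. For $1\le a<b\le n$, $(a,b)$ is a tree ascent of $T$ if (i) $a\in T^b_i$ for some $0\le i<s(b)$; (ii) whenever $a<e<b$ and $a\in T^e_j$, then $j=s(e)$; (iii) if $s(a)>0$ then $T^a_{s(a)}$ is a leaf. For a tree ascent $(a,b)$ of $T$, $(\mathrm{inv}(T)+(b,a))^{tc}$ equals $\mathrm{inv}(Z)$ for a unique $s$-decreasing tree $Z$, called the $s$-tree rotation of $T$ along $(a,b)$. It is known that $T\lessdot Z$ (cover) iff $Z$ is the $s$-tree rotation of $T$ along a unique tree ascent of $T$. An SB-labeling of a finite lattice $L$ is an edge labeling $\lambda$ of its Hasse diagram such that for all $u,v,w\in L$ with $v\ne w$ both covering $u$: (i) $\lambda(u,v)\neq\lambda(u,w)$; (ii) every saturated chain from $u$ to $v\vee w$ uses both labels $\lambda(u,v)$ and $\lambda(u,w)$ a positive number of times; (iii) no saturated chain from $u$ to $v\vee w$ uses any label other than $\lambda(u,v)$ and $\lambda(u,w)$. 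*)

theory Defs
  imports "HOL-Library.Multiset" "HOL-Algebra.Lattice"
begin

text \<open>
  A weak composition of length \<open>n\<close> is given by \<open>n\<close> together with a function \<open>s\<close>, of which
  only the values \<open>s 1, \<dots>, s n\<close> are ever used.
\<close>

datatype ltree = Leaf | Node nat "ltree list"

fun labels :: "ltree \<Rightarrow> nat list" where
  "labels Leaf = []"
| "labels (Node i ts) = i # concat (map labels ts)"

fun subtrees :: "ltree \<Rightarrow> ltree set" where
  "subtrees Leaf = {Leaf}"
| "subtrees (Node i ts) = insert (Node i ts) (\<Union>t\<in>set ts. subtrees t)"

definition s_decreasing_tree :: "nat \<Rightarrow> (nat \<Rightarrow> nat) \<Rightarrow> ltree \<Rightarrow> bool" where
  "s_decreasing_tree n s T \<longleftrightarrow>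
     distinct (labels T) \<and> set (labels T) = {1..n} \<and>
     (\<forall>i ts. Node i ts \<in> subtrees T \<longrightarrow>
        length ts = s i + 1 \<and> (\<forall>t\<in>set ts. \<forall>x\<in>set (labels t). x < i))"

text \<open>
  \<open>child_subtree T i j t\<close> says that \<open>t\<close> is the subtree \<open>T\<^sup>i\<^sub>j\<close>. It is a relation because \<open>T\<^sup>i\<^sub>j\<close>
  need not exist; on trees with distinct labels it is functional in \<open>t\<close>.
\<close>

definition child_subtree :: "ltree \<Rightarrow> nat \<Rightarrow> nat \<Rightarrow> ltree \<Rightarrow> bool" where
  "child_subtree T i j t \<longleftrightarrow> (\<exists>ts. Node i ts \<in> subtrees T \<and> j < length ts \<and> t = ts ! j)"

definition in_child :: "ltree \<Rightarrow> nat \<Rightarrow> nat \<Rightarrow> nat \<Rightarrow> bool" where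
  "in_child T i j x \<longleftrightarrow> (\<exists>t. child_subtree T i j t \<and> x \<in> set (labels t))"

text \<open>
  A vertex is to the left of another if at some vertex \<open>z\<close> (their lowest common ancestor) the
  first lies in a child subtree strictly to the left of the one containing the second.
\<close>

definition left_of :: "ltree \<Rightarrow> nat \<Rightarrow> nat \<Rightarrow> bool" where
  "left_of T x y \<longleftrightarrow> (\<exists>z j k. j < k \<and> in_child T z j x \<and> in_child T z k y)"

definition tree_card :: "(nat \<Rightarrow> nat) \<Rightarrow> ltree \<Rightarrow> nat \<Rightarrow> nat \<Rightarrow> nat" where
  "tree_card s T y x =
     (if left_of T x y \<or> in_child T y 0 x then 0
      else if in_child T y (s y) x \<or> left_of T y x then s y
      else (THE i. 0 < i \<and> i < s y \<and> in_child T y i x))"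

text \<open>
  Multi-inversion sets are multisets of pairs \<open>(y, x)\<close> with the larger entry first.
  Containment is \<open>\<subseteq>#\<close> from the library.
\<close>

definition inv_pairs :: "nat \<Rightarrow> (nat \<times> nat) set" where
  "inv_pairs n = {(y, x). 1 \<le> x \<and> x < y \<and> y \<le> n}"

definition multi_inv_set :: "nat \<Rightarrow> (nat \<times> nat) multiset \<Rightarrow> bool" where
  "multi_inv_set n I \<longleftrightarrow> set_mset I \<subseteq> inv_pairs n"

definition tree_inv :: "nat \<Rightarrow> (nat \<Rightarrow> nat) \<Rightarrow> ltree \<Rightarrow> (nat \<times> nat) multiset" where
  "tree_inv n s T = (\<Sum>(y, x)\<in>inv_pairs n. replicate_mset (tree_card s T y x) (y, x))"

text \<open>The truncated sum: the multiplicity of \<open>(y, x)\<close> is capped at \<open>s y\<close>.\<close>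

definition inv_plus ::
    "(nat \<Rightarrow> nat) \<Rightarrow> (nat \<times> nat) multiset \<Rightarrow> (nat \<times> nat) multiset \<Rightarrow> (nat \<times> nat) multiset" where
  "inv_plus s I J =
     (\<Sum>(y, x)\<in>set_mset I \<union> set_mset J.
        replicate_mset (min (count I (y, x) + count J (y, x)) (s y)) (y, x))"

definition inv_transitive :: "(nat \<times> nat) multiset \<Rightarrow> bool" where
  "inv_transitive I \<longleftrightarrow>
     (\<forall>a b c. a < b \<and> b < c \<longrightarrow> count I (b, a) = 0 \<or> count I (c, a) \<ge> count I (c, b))"

definition inv_tc :: "nat \<Rightarrow> (nat \<times> nat) multiset \<Rightarrow> (nat \<times> nat) multiset" where
  "inv_tc n I =
     (THE J. multi_inv_set n J \<and> inv_transitive J \<and> I \<subseteq># J \<and>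
        (\<forall>K. multi_inv_set n K \<and> inv_transitive K \<and> I \<subseteq># K \<longrightarrow> J \<subseteq># K))"

definition s_weak_order :: "nat \<Rightarrow> (nat \<Rightarrow> nat) \<Rightarrow> ltree gorder" where
  "s_weak_order n s =
     \<lparr>carrier = {T. s_decreasing_tree n s T}, eq = (=),
      le = (\<lambda>T Z. tree_inv n s T \<subseteq># tree_inv n s Z)\<rparr>"

definition tree_ascent :: "nat \<Rightarrow> (nat \<Rightarrow> nat) \<Rightarrow> ltree \<Rightarrow> nat \<Rightarrow> nat \<Rightarrow> bool" where
  "tree_ascent n s T a b \<longleftrightarrow>
     1 \<le> a \<and> a < b \<and> b \<le> n \<and>
     (\<exists>i<s b. in_child T b i a) \<and>
     (\<forall>e j. a < e \<and> e < b \<and> in_child T e j a \<longrightarrow> j = s e) \<and>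
     (s a > 0 \<longrightarrow> child_subtree T a (s a) Leaf)"

definition is_rotation :: "nat \<Rightarrow> (nat \<Rightarrow> nat) \<Rightarrow> ltree \<Rightarrow> nat \<Rightarrow> nat \<Rightarrow> ltree \<Rightarrow> bool" where
  "is_rotation n s T a b Z \<longleftrightarrow>
     tree_ascent n s T a b \<and> s_decreasing_tree n s Z \<and>
     tree_inv n s Z = inv_tc n (inv_plus s (tree_inv n s T) {#(b, a)#})"

definition ascent_label :: "nat \<Rightarrow> (nat \<Rightarrow> nat) \<Rightarrow> ltree \<Rightarrow> ltree \<Rightarrow> nat" where
  "ascent_label n s T Z = fst (THE (a, b). is_rotation n s T a b Z)"

definition covers :: "('a, 'c) gorder_scheme \<Rightarrow> 'a \<Rightarrow> 'a \<Rightarrow> bool" where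
  "covers L x y \<longleftrightarrow>
     x \<in> carrier L \<and> y \<in> carrier L \<and> x \<sqsubset>\<^bsub>L\<^esub> y \<and>
     \<not> (\<exists>z\<in>carrier L. x \<sqsubset>\<^bsub>L\<^esub> z \<and> z \<sqsubset>\<^bsub>L\<^esub> y)"

definition saturated_chain :: "('a, 'c) gorder_scheme \<Rightarrow> 'a \<Rightarrow> 'a \<Rightarrow> 'a list \<Rightarrow> bool" where
  "saturated_chain L x y c \<longleftrightarrow>
     c \<noteq> [] \<and> set c \<subseteq> carrier L \<and> hd c = x \<and> last c = y \<and> successively (covers L) c"

definition chain_labels :: "('a \<Rightarrow> 'a \<Rightarrow> 'l) \<Rightarrow> 'a list \<Rightarrow> 'l list" where
  "chain_labels lam c = map (\<lambda>(x, y). lam x y) (zip c (tl c))"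

text \<open>Only the values of \<open>lam\<close> on cover relations of \<open>L\<close> matter.\<close>

definition SB_labeling :: "('a, 'c) gorder_scheme \<Rightarrow> ('a \<Rightarrow> 'a \<Rightarrow> 'l) \<Rightarrow> bool" where
  "SB_labeling L lam \<longleftrightarrow>
     lattice L \<and> finite (carrier L) \<and>
     (\<forall>u v w. covers L u v \<and> covers L u w \<and> v \<noteq> w \<longrightarrow>
        lam u v \<noteq> lam u w \<and>
        (\<forall>c. saturated_chain L u (v \<squnion>\<^bsub>L\<^esub> w) c \<longrightarrow>
           lam u v \<in> set (chain_labels lam c) \<and> lam u w \<in> set (chain_labels lam c)) \<and>
        (\<forall>c. saturated_chain L u (v \<squnion>\<^bsub>L\<^esub> w) c \<longrightarrow>
           set (chain_labels lam c) \<subseteq> {lam u v, lam u w}))"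

end

theory Submission
  imports Defs
begin

text \<open>
  A tree is encoded by the function \<open>f y x = #\<^sub>T(y, x)\<close>. The functions that arise are exactly those
  bounded by \<open>s\<close> that are transitive (\<open>x < z < y\<close> and \<open>f z x > 0\<close> imply \<open>f y z \<le> f y x\<close>) and planar
  (\<open>x < z < y\<close> and \<open>f z x < s z\<close> imply \<open>f y x \<le> f y z\<close>). The transitive closure
  \<open>(y, x) \<mapsto> max {m y e | e \<rightarrow> \<dots> \<rightarrow> x}\<close>, taken over paths of positive entries of \<open>m\<close>, preserves planarity:
  a path passing over \<open>z\<close> can be rerouted through \<open>z\<close>. Hence the pointwise supremum of any family of
  trees has a tree as its transitive closure, which gives the lattice structure.

  The rotation along \<open>(a, b)\<close> only increases entries \<open>(b, x)\<close> with \<open>x \<le> a\<close>, each by at most one. If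
  \<open>f < g\<close>, then some ascent \<open>(a, b)\<close> of \<open>f\<close> has \<open>f b a < g b a\<close>, so covers are rotations. For two
  ascents \<open>(a, b)\<close>, \<open>(a', b')\<close> of \<open>f\<close> with \<open>a' < a\<close>, the join of the two rotations lies below an
  explicit transitive function that exceeds \<open>f\<close> by one at the vertices moving with \<open>a\<close> or \<open>a'\<close>. Between
  \<open>f\<close> and this bound, a vertex \<open>x\<close> moving with \<open>d \<noteq> x\<close> would need \<open>g d x = s d\<close> to be the label of an
  ascent of \<open>g\<close>, which the bound excludes; so only \<open>a\<close> and \<open>a'\<close> occur as labels. The label \<open>a\<close> is needed
  because steps labeled \<open>a'\<close> leave column \<open>a\<close> unchanged, and \<open>a'\<close> is needed because after the rotation
  along \<open>(a, b)\<close> the bound admits no further step labeled \<open>a\<close>.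
\<close>

subsection \<open>Transitive and planar functions\<close>

definition transitive_fun :: "(nat \<Rightarrow> nat \<Rightarrow> nat) \<Rightarrow> bool" where
  "transitive_fun f \<longleftrightarrow> (\<forall>x z y. x < z \<and> z < y \<and> 0 < f z x \<longrightarrow> f y z \<le> f y x)"

text \<open>For \<open>f\<close> bounded by \<open>s\<close> this is transitivity of the mirrored
  function \<open>s y - f y x\<close>, which corresponds to reversing the order of the children of
  every vertex.\<close>

definition planar_fun :: "(nat \<Rightarrow> nat) \<Rightarrow> (nat \<Rightarrow> nat \<Rightarrow> nat) \<Rightarrow> bool" where
  "planar_fun s f \<longleftrightarrow> (\<forall>x z y. x < z \<and> z < y \<and> f z x < s z \<longrightarrow> f y x \<le> f y z)"

definition bounded_fun :: "nat \<Rightarrow> (nat \<Rightarrow> nat) \<Rightarrow> (nat \<Rightarrow> nat \<Rightarrow> nat) \<Rightarrow> bool" where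
  "bounded_fun n s f \<longleftrightarrow>
     (\<forall>y x. f y x \<le> s y) \<and> (\<forall>y x. f y x \<noteq> 0 \<longrightarrow> 1 \<le> x \<and> x < y \<and> y \<le> n)"

definition inv_fun :: "nat \<Rightarrow> (nat \<Rightarrow> nat) \<Rightarrow> (nat \<Rightarrow> nat \<Rightarrow> nat) \<Rightarrow> bool" where
  "inv_fun n s f \<longleftrightarrow> bounded_fun n s f \<and> transitive_fun f \<and> planar_fun s f"

lemma transitive_funD: "transitive_fun f \<Longrightarrow> x < z \<Longrightarrow> z < y \<Longrightarrow> 0 < f z x \<Longrightarrow> f y z \<le> f y x"
  unfolding transitive_fun_def by blast

lemma planar_funD: "planar_fun s f \<Longrightarrow> x < z \<Longrightarrow> z < y \<Longrightarrow> f z x < s z \<Longrightarrow> f y x \<le> f y z"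
  unfolding planar_fun_def by blast

lemma inv_fun_trans: "inv_fun n s f \<Longrightarrow> x < z \<Longrightarrow> z < y \<Longrightarrow> 0 < f z x \<Longrightarrow> f y z \<le> f y x"
  unfolding inv_fun_def using transitive_funD by blast

lemma inv_fun_planar: "inv_fun n s f \<Longrightarrow> x < z \<Longrightarrow> z < y \<Longrightarrow> f z x < s z \<Longrightarrow> f y x \<le> f y z"
  unfolding inv_fun_def using planar_funD by blast

lemma inv_fun_le: "inv_fun n s f \<Longrightarrow> f y x \<le> s y"
  unfolding inv_fun_def bounded_fun_def by blast

lemma inv_fun_supp: "inv_fun n s f \<Longrightarrow> 0 < f y x \<Longrightarrow> 1 \<le> x \<and> x < y \<and> y \<le> n"
  unfolding inv_fun_def bounded_fun_def by blast

subsection \<open>Transitive closure\<close>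

definition pos_steps :: "(nat \<Rightarrow> nat \<Rightarrow> nat) \<Rightarrow> (nat \<times> nat) set" where
  "pos_steps m = {(p, q). q < p \<and> 0 < m p q}"

text \<open>Along a chain \<open>y, e, ..., x\<close> of positive entries, transitivity carries the
  first multiplicity \<open>m y e\<close> unchanged to \<open>(y, x)\<close>; the later entries
  matter only by being positive. The empty path contributes \<open>m y x\<close> itself.\<close>

definition tc_fun :: "(nat \<Rightarrow> nat \<Rightarrow> nat) \<Rightarrow> nat \<Rightarrow> nat \<Rightarrow> nat" where
  "tc_fun m y x = (if x < y then Max (m y ` {e. e < y \<and> (e, x) \<in> (pos_steps m)\<^sup>*}) else 0)"

lemma pos_steps_rtrancl_le: "(e, x) \<in> (pos_steps m)\<^sup>* \<Longrightarrow> x \<le> e"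
  by (induction rule: rtrancl_induct) (auto simp: pos_steps_def)

lemma tc_fun_ge_path: "(e, x) \<in> (pos_steps m)\<^sup>* \<Longrightarrow> e < y \<Longrightarrow> m y e \<le> tc_fun m y x"
  using pos_steps_rtrancl_le[of e x m] unfolding tc_fun_def by (auto intro: Max_ge)

lemma tc_fun_path:
  assumes "x < y"
  obtains e where "e < y" "(e, x) \<in> (pos_steps m)\<^sup>*" "tc_fun m y x = m y e"
proof -
  let ?A = "m y ` {e. e < y \<and> (e, x) \<in> (pos_steps m)\<^sup>*}"
  have "finite ?A" "?A \<noteq> {}" using assms by auto
  then have "Max ?A \<in> ?A" by (rule Max_in)
  then show ?thesis using that assms unfolding tc_fun_def by auto
qed

lemma tc_fun_ge: "x < y \<Longrightarrow> m y x \<le> tc_fun m y x"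
  by (rule tc_fun_ge_path) auto

text \<open>Every step of a path is positive in \<open>K\<close> too, so transitivity of
  \<open>K\<close> pushes the value \<open>K y e\<close> down the path to
  \<open>K y x\<close>.\<close>

lemma tc_fun_least:
  assumes K: "transitive_fun K" and le: "\<And>y x. x < y \<Longrightarrow> m y x \<le> K y x"
  shows "tc_fun m y x \<le> K y x"
proof (cases "x < y")
  case True
  then obtain e where e: "e < y" "(e, x) \<in> (pos_steps m)\<^sup>*" "tc_fun m y x = m y e"
    by (rule tc_fun_path)
  from e(2) have "K y e \<le> K y x"
  proof (induction rule: rtrancl_induct)
    case (step q x)
    then have "q \<le> e" "x < q" "0 < K q x"
      using pos_steps_rtrancl_le le[of x q] by (fastforce simp: pos_steps_def)+
    then have "K y q \<le> K y x" using e(1) by (intro transitive_funD[OF K]) auto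
    then show ?case using step.IH by simp
  qed simp
  then show ?thesis using le[OF e(1)] e(3) by simp
qed (simp add: tc_fun_def)

lemma tc_fun_transitive: "transitive_fun (tc_fun m)"
  unfolding transitive_fun_def
proof (intro allI impI)
  fix x z y assume h: "x < z \<and> z < y \<and> 0 < tc_fun m z x"
  obtain e where e: "e < z" "(e, x) \<in> (pos_steps m)\<^sup>*" "tc_fun m z x = m z e"
    using h by (auto elim: tc_fun_path[of x z m])
  \<comment> \<open>The entry \<open>m z e\<close> is positive, so the path to \<open>x\<close> can
    be started at \<open>z\<close> and appended to any path ending in \<open>z\<close>.\<close>
  then have "(z, x) \<in> (pos_steps m)\<^sup>*"
    using h by (auto simp: pos_steps_def intro: converse_rtrancl_into_rtrancl)
  moreover obtain d where "d < y" "(d, z) \<in> (pos_steps m)\<^sup>*" "tc_fun m y z = m y d"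
    using h by (auto elim: tc_fun_path[of z y m])
  ultimately show "tc_fun m y z \<le> tc_fun m y x"
    by (metis rtrancl_trans tc_fun_ge_path)
qed

text \<open>Consider the step \<open>d\<close> to \<open>e\<close> that jumps over \<open>b\<close>.
  Since \<open>e\<close> still reaches \<open>a\<close>, \<open>m b e\<close> is at most
  \<open>tc_fun m b a\<close>, hence below \<open>s b\<close>. Planarity then gives
  \<open>m d e \<le> m d b\<close>, so there is a direct step from \<open>d\<close> to
  \<open>b\<close>.\<close>

lemma tc_fun_path_through:
  assumes "planar_fun s m" "(d, a) \<in> (pos_steps m)\<^sup>*" "a < b" "b \<le> d" "tc_fun m b a < s b"
  shows "(d, b) \<in> (pos_steps m)\<^sup>*"
  using assms(2,4)
proof (induction rule: converse_rtrancl_induct)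
  case base
  then show ?case using assms(3) by simp
next
  case (step d e)
  show ?case
  proof (cases "b \<le> e \<or> d = b")
    case True
    then show ?thesis using step by (meson converse_rtrancl_into_rtrancl rtrancl.rtrancl_refl)
  next
    case False
    then have "m b e < s b" "e < b" "b < d"
      using tc_fun_ge_path[OF step(2), of b] assms(5) step(4) by auto
    then have "m d e \<le> m d b" using planar_funD[OF assms(1)] by blast
    then show ?thesis using step(1) \<open>b < d\<close> by (auto simp: pos_steps_def)
  qed
qed

text \<open>Let \<open>d\<close> attain the maximum for \<open>(c, a)\<close>. If \<open>d\<close>
  is at least \<open>b\<close>, its path can be routed through \<open>b\<close>, so
  \<open>m c d\<close> also counts for \<open>(c, b)\<close>. If \<open>d\<close> is below
  \<open>b\<close>, planarity of \<open>m\<close> compares \<open>m c d\<close> with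
  \<open>m c b\<close> directly.\<close>

lemma tc_fun_planar:
  assumes P: "planar_fun s m"
  shows "planar_fun s (tc_fun m)"
  unfolding planar_fun_def
proof (intro allI impI)
  fix a b c assume h: "a < b \<and> b < c \<and> tc_fun m b a < s b"
  obtain d where d: "d < c" "(d, a) \<in> (pos_steps m)\<^sup>*" "tc_fun m c a = m c d"
    using h tc_fun_path[of a c m] less_trans by metis
  show "tc_fun m c a \<le> tc_fun m c b"
  proof (cases "b \<le> d")
    case True
    then show ?thesis using tc_fun_path_through[OF P d(2)] h d tc_fun_ge_path by metis
  next
    case False
    then have "m b d < s b" using tc_fun_ge_path[OF d(2), of b] h by auto
    then have "m c d \<le> m c b" using planar_funD[OF P] False h by auto
    also have "\<dots> \<le> tc_fun m c b" using h tc_fun_ge by blast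
    finally show ?thesis using d(3) by simp
  qed
qed

lemma tc_fun_bounded:
  assumes B: "bounded_fun n s m"
  shows "bounded_fun n s (tc_fun m)"
  unfolding bounded_fun_def
proof (intro conjI allI impI)
  fix y x
  show "tc_fun m y x \<le> s y"
    using tc_fun_least[of "\<lambda>y x. s y" m] B by (simp add: transitive_fun_def bounded_fun_def)
next
  fix y x assume nz: "tc_fun m y x \<noteq> 0"
  then show "x < y" by (auto simp: tc_fun_def split: if_splits)
  then obtain e where e: "e < y" "(e, x) \<in> (pos_steps m)\<^sup>*" "tc_fun m y x = m y e"
    by (rule tc_fun_path)
  then have "1 \<le> e" "y \<le> n" using nz B unfolding bounded_fun_def by auto
  \<comment> \<open>Either \<open>x\<close> is \<open>e\<close>, or it is the lower end of a
    positive step.\<close>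
  from e(2) \<open>1 \<le> e\<close> show "1 \<le> x"
    using B by (cases rule: rtrancl.cases) (fastforce simp: pos_steps_def bounded_fun_def)+
  show "y \<le> n" by fact
qed

lemma inv_fun_tc: "bounded_fun n s m \<Longrightarrow> planar_fun s m \<Longrightarrow> inv_fun n s (tc_fun m)"
  by (simp add: inv_fun_def tc_fun_bounded tc_fun_planar tc_fun_transitive)

text \<open>A pointwise supremum inherits the bound and planarity from the members of
  \<open>F\<close>. Only transitivity can fail, and the closure restores it while keeping the other
  two.\<close>

lemma inv_fun_lub:
  assumes "\<And>h. h \<in> F \<Longrightarrow> inv_fun n s h"
  shows "\<exists>j. inv_fun n s j \<and> (\<forall>h\<in>F. h \<le> j) \<and> (\<forall>k. inv_fun n s k \<longrightarrow> (\<forall>h\<in>F. h \<le> k) \<longrightarrow> j \<le> k)"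
proof -
  \<comment> \<open>The supremum of the empty set of natural numbers is 0, so an empty
    \<open>F\<close> yields the zero function. For infinite \<open>F\<close> the bound
    \<open>s y\<close> makes the supremum meaningful.\<close>
  define m where "m = (\<lambda>y x. Sup ((\<lambda>h. h y x) ` F) :: nat)"
  have least: "m y x \<le> u" if "\<And>h. h \<in> F \<Longrightarrow> h y x \<le> u" for y x u
  proof (cases "F = {}")
    case False
    then show ?thesis unfolding m_def using that by (auto intro: cSUP_least)
  qed (simp add: m_def)
  have upper: "h y x \<le> m y x" if "h \<in> F" for h y x
    unfolding m_def using that assms
    by (intro cSUP_upper bdd_aboveI[of _ "s y"]) (auto dest: inv_fun_le)
  have P: "planar_fun s m"
    unfolding planar_fun_def
  proof (intro allI impI)
    fix x z y assume h: "x < z \<and> z < y \<and> m z x < s z"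
    show "m y x \<le> m y z"
    proof (rule least)
      fix k assume k: "k \<in> F"
      then have "k z x < s z" using upper[OF k, of z x] h by simp
      then have "k y x \<le> k y z" using assms[OF k] h inv_fun_planar by blast
      then show "k y x \<le> m y z" using upper[OF k, of y z] by simp
    qed
  qed
  have B: "bounded_fun n s m"
    unfolding bounded_fun_def
  proof (intro conjI allI impI)
    show "m y x \<le> s y" for y x by (rule least) (use assms inv_fun_le in blast)
  next
    fix y x assume "m y x \<noteq> 0"
    then have "\<exists>h\<in>F. 0 < h y x" using least[of y x 0] by (metis bot_nat_0.not_eq_extremum le_zero_eq)
    then show "1 \<le> x" "x < y" "y \<le> n" using inv_fun_supp assms by metis+
  qed
  show ?thesis
  proof (intro exI conjI ballI allI impI)
    show "inv_fun n s (tc_fun m)" by (rule inv_fun_tc[OF B P])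
  next
    fix h assume h: "h \<in> F"
    show "h \<le> tc_fun m"
    proof (intro le_funI)
      fix y x show "h y x \<le> tc_fun m y x"
        using upper[OF h, of y x] tc_fun_ge[of x y m] inv_fun_supp[OF assms[OF h], of y x]
        by (cases "h y x = 0") auto
    qed
  next
    fix k assume k: "inv_fun n s k" "\<forall>h\<in>F. h \<le> k"
    then show "tc_fun m \<le> k"
      by (intro le_funI tc_fun_least) (auto simp: inv_fun_def le_fun_def intro: least)
  qed
qed

subsection \<open>Ascents\<close>

text \<open>For the function of a tree this says that \<open>a\<close> is a descendant of
  \<open>b\<close>: a larger vertex that separated the two would give them different entries. See
  \<open>in_child_iff_descends\<close>.\<close>

definition descends :: "(nat \<Rightarrow> nat \<Rightarrow> nat) \<Rightarrow> nat \<Rightarrow> nat \<Rightarrow> bool" where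
  "descends f b a \<longleftrightarrow> a < b \<and> (\<forall>c>b. f c a = f c b)"

definition fun_ascent :: "nat \<Rightarrow> (nat \<Rightarrow> nat) \<Rightarrow> (nat \<Rightarrow> nat \<Rightarrow> nat) \<Rightarrow> nat \<Rightarrow> nat \<Rightarrow> bool" where
  "fun_ascent n s f a b \<longleftrightarrow>
     1 \<le> a \<and> b \<le> n \<and> descends f b a \<and> f b a < s b \<and>
     (\<forall>e. a < e \<and> e < b \<and> descends f e a \<longrightarrow> f e a = s e) \<and>
     (0 < s a \<longrightarrow> (\<forall>x. descends f a x \<longrightarrow> f a x \<noteq> s a))"

lemma descends_trans: "descends f c b \<Longrightarrow> descends f b a \<Longrightarrow> descends f c a"
  unfolding descends_def by auto

lemma descends_between: "descends f c a \<Longrightarrow> descends f b a \<Longrightarrow> b < c \<Longrightarrow> descends f c b"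
  unfolding descends_def by auto

text \<open>Of two candidates, the smaller one lies strictly between \<open>a\<close> and the
  larger, so its entry would have to be maximal, while as the top of an ascent it is not. Hence the
  label \<open>a\<close> alone determines the ascent.\<close>

lemma fun_ascent_unique:
  assumes "fun_ascent n s f a b" "fun_ascent n s f a b'"
  shows "b = b'"
  using assms unfolding fun_ascent_def descends_def
  by (metis linorder_neqE_nat nat_neq_iff)

lemma last_difference:
  assumes f: "inv_fun n s f" and "m < c0" "f c0 p \<noteq> f c0 q"
  obtains c where "m < c" "f c p \<noteq> f c q" "\<And>c'. c < c' \<Longrightarrow> f c' p = f c' q"
proof -
  let ?A = "{c. m < c \<and> f c p \<noteq> f c q}"
  have "?A \<subseteq> {..n}" using inv_fun_supp[OF f] by (auto, metis neq0_conv)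
  then have fin: "finite ?A" using finite_subset by blast
  have "Max ?A \<in> ?A" using assms by (intro Max_in fin) auto
  moreover have "f c' p = f c' q" if "Max ?A < c'" for c'
    using Max_ge[OF fin, of c'] that \<open>Max ?A \<in> ?A\<close> by fastforce
  ultimately show ?thesis using that by blast
qed

text \<open>Planarity at \<open>p\<close> and transitivity at \<open>q\<close> squeeze
  \<open>f c' c\<close> between \<open>f c' p\<close> and \<open>f c' q\<close>, which agree above
  \<open>c\<close>. In a tree, \<open>c\<close> is the lowest common ancestor, and \<open>p\<close>
  lies in a child to the left of the one containing \<open>q\<close>.\<close>

lemma common_ancestor:
  assumes f: "inv_fun n s f" and "p < c" "q < c" "f c p < f c q"
    and above: "\<And>c'. c < c' \<Longrightarrow> f c' p = f c' q"
  shows "descends f c p"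
  unfolding descends_def
proof (intro conjI allI impI)
  fix c' assume "c < c'"
  moreover have "f c p < s c" using inv_fun_le[OF f, of c q] assms(4) by simp
  ultimately have "f c' p \<le> f c' c" "f c' c \<le> f c' q"
    using inv_fun_planar[OF f, of p c c'] inv_fun_trans[OF f, of q c c'] assms by auto
  then show "f c' p = f c' c" using above[OF \<open>c < c'\<close>] by simp
qed fact

text \<open>Here \<open>z\<close> branches off to the right of \<open>a\<close> at \<open>c\<close>.
  If \<open>c\<close> were below \<open>b\<close>, then \<open>a\<close> would not lie in the last
  child of \<open>c\<close>, against the ascent condition. If \<open>c\<close> is above
  \<open>b\<close>, then \<open>z\<close> is to the right of \<open>b\<close> as well, and planarity
  forces \<open>f b z\<close> to be maximal.\<close>

lemma ascent_right:
  assumes f: "inv_fun n s f" and A: "fun_ascent n s f a b"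
    and "z < b" "a < c" "z < c" "f c a < f c z" "\<And>c'. c < c' \<Longrightarrow> f c' a = f c' z"
  shows "f b a < f b z"
proof -
  have D: "descends f c a" using common_ancestor[OF f] assms by blast
  have lt: "f c a < s c" using inv_fun_le[OF f, of c z] assms(6) by simp
  consider "c < b" | "c = b" | "b < c" by linarith
  then show ?thesis
  proof cases
    case 1
    then show ?thesis using A D lt assms(4) unfolding fun_ascent_def by auto
  next
    case 3
    then have "f c b = f c a" using A unfolding fun_ascent_def descends_def by auto
    then have "\<not> f b z < s b" using inv_fun_planar[OF f, of z b c] 3 assms by auto
    then show ?thesis using A unfolding fun_ascent_def by auto
  qed (use assms in auto)
qed

text \<open>These are the vertices that move together with \<open>d\<close> in a rotation along an
  ascent \<open>(d, b)\<close>: raising the entry at \<open>(b, d)\<close> forces, by transitivity,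
  the entries at \<open>(b, x)\<close> with \<open>f d x\<close> positive. The first child of
  \<open>d\<close> stays behind.\<close>

definition carried :: "(nat \<Rightarrow> nat \<Rightarrow> nat) \<Rightarrow> nat \<Rightarrow> nat set" where
  "carried f d = {x. x = d \<or> descends f d x \<and> 0 < f d x}"

lemma carried_le: "x \<in> carried f d \<Longrightarrow> x \<le> d"
  by (auto simp: carried_def descends_def)

lemma carried_self: "d \<in> carried f d"
  by (simp add: carried_def)

lemma carried_descends:
  assumes "fun_ascent n s f d b" "x \<in> carried f d"
  shows "descends f b x" "f b x = f b d"
proof -
  have D: "descends f b d" using assms(1) by (simp add: fun_ascent_def)
  then show "descends f b x" using assms(2) descends_trans[OF D] by (auto simp: carried_def)
  show "f b x = f b d" using D assms(2) by (auto simp: carried_def descends_def)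
qed

text \<open>The last child of \<open>d\<close> is a leaf by the ascent condition, so a carried
  vertex other than \<open>d\<close> lies in a child that is neither first nor last.\<close>

lemma carried_less:
  assumes f: "inv_fun n s f" and A: "fun_ascent n s f d b" and x: "x \<in> carried f d" "x \<noteq> d"
  shows "x < d" "0 < f d x" "f d x < s d"
proof -
  show "x < d" "0 < f d x" using x by (auto simp: carried_def descends_def)
  then have "f d x \<noteq> s d" using A x by (auto simp: fun_ascent_def carried_def)
  then show "f d x < s d" using inv_fun_le[OF f, of d x] by simp
qed

text \<open>Transitivity makes \<open>f d x\<close> positive, so \<open>x\<close>, not being
  carried, is no descendant of \<open>d\<close> and must lie to its right. Then
  \<open>ascent_right\<close> shows that row \<open>b\<close> already leaves room for raising the
  entry of \<open>d\<close>.\<close>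

lemma not_carried_right:
  assumes f: "inv_fun n s f" and A: "fun_ascent n s f d b"
    and z: "z \<in> carried f d" and x: "x < z" "0 < f z x" "x \<notin> carried f d"
  shows "f b d < f b x" "0 < f d x"
proof -
  show pos: "0 < f d x"
  proof (cases "z = d")
    case False
    then have "z < d" "0 < f d z" using carried_less[OF f A z] by auto
    then show ?thesis using inv_fun_trans[OF f, of x z d] x by auto
  qed (use x in simp)
  have xd: "x < d" using carried_le[OF z] x by simp
  then have "\<not> descends f d x" using x pos by (auto simp: carried_def)
  then obtain c0 where "d < c0" "f c0 x \<noteq> f c0 d" using xd by (auto simp: descends_def)
  then obtain c where c: "d < c" "f c d \<noteq> f c x" "\<And>c'. c < c' \<Longrightarrow> f c' d = f c' x"
    using last_difference[OF f, of d c0 d x] by metis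
  then have "f c d < f c x" using inv_fun_trans[OF f, of x d c] xd pos by simp
  moreover have "d < b" using A by (simp add: fun_ascent_def descends_def)
  ultimately show "f b d < f b x" using ascent_right[OF f A, of x c] c xd by simp
qed

text \<open>An entry \<open>(z, x)\<close> that becomes positive imposes new inequalities on the
  rows above \<open>z\<close>; they hold with equality because \<open>x\<close> descends from
  \<open>z\<close>, and \<open>comp\<close> keeps this so after the increment. For old positive
  entries, \<open>right\<close> supplies the missing unit.\<close>

lemma transitive_increment:
  assumes f: "inv_fun n s f"
    and desc: "\<And>z x. S z x \<Longrightarrow> descends f z x"
    and comp: "\<And>y z x. S z x \<Longrightarrow> S y z \<Longrightarrow> S y x"
    and right: "\<And>y z x. S y z \<Longrightarrow> x < z \<Longrightarrow> 0 < f z x \<Longrightarrow> \<not> S y x \<Longrightarrow> f y z < f y x"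
  shows "transitive_fun (\<lambda>y x. f y x + of_bool (S y x))"
  unfolding transitive_fun_def
proof (intro allI impI)
  fix x z y assume h: "x < z \<and> z < y \<and> 0 < f z x + of_bool (S z x)"
  show "f y z + of_bool (S y z) \<le> f y x + of_bool (S y x)"
  proof (cases "S z x")
    case True
    then have "f y x = f y z" using desc[OF True] h by (auto simp: descends_def)
    then show ?thesis using comp[OF True, of y] by auto
  next
    case False
    then have "0 < f z x" using h by simp
    then show ?thesis
      using inv_fun_trans[OF f, of x z y] h right[of y z x] by (cases "S y z"; cases "S y x") auto
  qed
qed

section \<open>Rotations as closures of a single increment\<close>

definition add_pair :: "(nat \<Rightarrow> nat \<Rightarrow> nat) \<Rightarrow> nat \<Rightarrow> nat \<Rightarrow> nat \<Rightarrow> nat \<Rightarrow> nat" where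
  "add_pair f a b y x = f y x + of_bool (y = b \<and> x = a)"

lemma add_pair_bounded:
  assumes f: "inv_fun n s f" and A: "fun_ascent n s f a b"
  shows "bounded_fun n s (add_pair f a b)"
  unfolding bounded_fun_def
proof (intro conjI allI impI)
  fix y x
  show "add_pair f a b y x \<le> s y"
    using inv_fun_le[OF f, of y x] A by (auto simp: add_pair_def fun_ascent_def)
  assume "add_pair f a b y x \<noteq> 0"
  then have "0 < f y x \<or> y = b \<and> x = a" by (auto simp: add_pair_def split: if_splits)
  then have "1 \<le> x \<and> x < y \<and> y \<le> n"
    using inv_fun_supp[OF f, of y x] A by (auto simp: fun_ascent_def descends_def)
  then show "1 \<le> x" "x < y" "y \<le> n" by simp_all
qed

text \<open>Only the raised entry \<open>(b, a)\<close> can cause trouble. A vertex \<open>z\<close>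
  between \<open>a\<close> and \<open>b\<close> with \<open>f z a < s z\<close> cannot be an
  ancestor of \<open>a\<close>, so \<open>a\<close> and \<open>z\<close> separate in a row above
  \<open>z\<close>, with \<open>z\<close> on the right. Hence \<open>f b z\<close> already exceeds
  \<open>f b a\<close>.\<close>

lemma add_pair_planar:
  assumes f: "inv_fun n s f" and A: "fun_ascent n s f a b"
  shows "planar_fun s (add_pair f a b)"
  unfolding planar_fun_def
proof (intro allI impI)
  fix x z y assume h: "x < z \<and> z < y \<and> add_pair f a b z x < s z"
  then have fz: "f z x < s z" by (simp add: add_pair_def)
  then have le: "f y x \<le> f y z" using inv_fun_planar[OF f] h by blast
  show "add_pair f a b y x \<le> add_pair f a b y z"
  proof (cases "y = b \<and> x = a")
    case True
    have "\<not> descends f z a" using A True h fz by (auto simp: fun_ascent_def)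
    then obtain c0 where "z < c0" "f c0 a \<noteq> f c0 z" using True h by (auto simp: descends_def)
    then obtain c where c: "z < c" "f c a \<noteq> f c z" "\<And>c'. c < c' \<Longrightarrow> f c' a = f c' z"
      using last_difference[OF f, of z c0 a z] by metis
    then have "f c a < f c z" using inv_fun_planar[OF f, of x z c] True h fz by auto
    then have "f b a < f b z" using ascent_right[OF f A, of z c] c True h by simp
    then show ?thesis using True by (simp add: add_pair_def)
  qed (use le in \<open>auto simp: add_pair_def\<close>)
qed

definition rotate_fun :: "(nat \<Rightarrow> nat \<Rightarrow> nat) \<Rightarrow> nat \<Rightarrow> nat \<Rightarrow> nat \<Rightarrow> nat \<Rightarrow> nat" where
  "rotate_fun f a b = tc_fun (add_pair f a b)"

lemma rotate_fun_inv_fun: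
  "inv_fun n s f \<Longrightarrow> fun_ascent n s f a b \<Longrightarrow> inv_fun n s (rotate_fun f a b)"
  unfolding rotate_fun_def by (intro inv_fun_tc add_pair_bounded add_pair_planar)

lemma rotate_fun_ge:
  assumes f: "inv_fun n s f"
  shows "f \<le> rotate_fun f a b"
proof (intro le_funI)
  fix y x show "f y x \<le> rotate_fun f a b y x"
    using inv_fun_supp[OF f, of y x] tc_fun_ge[of x y "add_pair f a b"]
    by (cases "f y x = 0") (auto simp: rotate_fun_def add_pair_def)
qed

lemma rotate_fun_increases: "a < b \<Longrightarrow> f b a < rotate_fun f a b b a"
  using tc_fun_ge[of a b "add_pair f a b"] by (simp add: rotate_fun_def add_pair_def)

lemma rotate_fun_least:
  assumes "transitive_fun g" "f \<le> g" "f b a < g b a"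
  shows "rotate_fun f a b \<le> g"
  unfolding rotate_fun_def using assms
  by (intro le_funI tc_fun_least) (auto simp: add_pair_def le_fun_def Suc_le_eq)

text \<open>The right-hand side is itself transitive and dominates \<open>add_pair f a b\<close>, so
  it dominates the closure.\<close>

lemma rotate_fun_le:
  assumes f: "inv_fun n s f" and A: "fun_ascent n s f a b"
  shows "rotate_fun f a b y x \<le> f y x + of_bool (y = b \<and> x \<in> carried f a)"
proof -
  have "transitive_fun (\<lambda>y x. f y x + of_bool (y = b \<and> x \<in> carried f a))"
  proof (rule transitive_increment[OF f])
    show "descends f z x" if "z = b \<and> x \<in> carried f a" for z x
      using that carried_descends[OF A] by blast
    show "y = b \<and> x \<in> carried f a" if "z = b \<and> x \<in> carried f a" "y = b \<and> z \<in> carried f a" for y z x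
      using that by blast
    show "f y z < f y x"
      if "y = b \<and> z \<in> carried f a" "x < z" "0 < f z x" "\<not> (y = b \<and> x \<in> carried f a)" for y z x
      using that not_carried_right[OF f A, of z x] carried_descends[OF A] by auto
  qed
  then have "tc_fun (add_pair f a b) y x \<le> f y x + of_bool (y = b \<and> x \<in> carried f a)"
    by (rule tc_fun_least) (auto simp: add_pair_def carried_self)
  then show ?thesis by (simp add: rotate_fun_def)
qed

lemma rotate_fun_changes:
  assumes f: "inv_fun n s f" and A: "fun_ascent n s f a b" and "rotate_fun f a b y x \<noteq> f y x"
  shows "y = b \<and> x \<le> a"
proof -
  have "f y x \<le> rotate_fun f a b y x" using rotate_fun_ge[OF f] by (auto simp: le_fun_def)
  then show ?thesis
    using rotate_fun_le[OF f A, of y x] assms(3) carried_le[of x f a]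
    by (cases "y = b \<and> x \<in> carried f a") auto
qed

text \<open>The pair can be read off from the changed entries: \<open>b\<close> is the only row that
  changes, and \<open>a\<close> is the largest column changed there.\<close>

lemma rotate_fun_unique:
  assumes f: "inv_fun n s f" and A: "fun_ascent n s f a b" and A': "fun_ascent n s f a' b'"
    and eq: "rotate_fun f a b = rotate_fun f a' b'"
  shows "a = a'" "b = b'"
proof -
  have "a < b" "a' < b'" using A A' by (auto simp: fun_ascent_def descends_def)
  then have "rotate_fun f a b b a \<noteq> f b a" "rotate_fun f a' b' b' a' \<noteq> f b' a'"
    using rotate_fun_increases[of a b f] rotate_fun_increases[of a' b' f] by auto
  then have "b = b' \<and> a \<le> a'" "b' = b \<and> a' \<le> a"
    using rotate_fun_changes[OF f A, of b' a'] rotate_fun_changes[OF f A', of b a] eq by simp_all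
  then show "a = a'" "b = b'" by auto
qed

text \<open>The ascent is found by three extremal choices. First \<open>b\<close> is the lowest row
  in which the entry of some descendant grows. Among those descendants the largest satisfies the
  condition on the vertices between it and \<open>b\<close>. Among all that satisfy this condition,
  collected in \<open>R\<close>, the smallest also satisfies the leaf condition.\<close>

lemma exists_ascent_below:
  assumes f: "inv_fun n s f" and g: "inv_fun n s g" and le: "f \<le> g" and ne: "f \<noteq> g"
  obtains a b where "fun_ascent n s f a b" "f b a < g b a"
proof -
  have le': "f y x \<le> g y x" for y x using le by (simp add: le_fun_def)
  define P where "P b a \<longleftrightarrow> descends f b a \<and> f b a < g b a" for b a
  have "\<exists>b a. P b a"
  proof -
    obtain b0 a where "f b0 a < g b0 a"
      using le' ne by (metis ext le_neq_implies_less)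
    moreover have bd: "b \<le> n" if "f b a < g b a" for b
      using inv_fun_supp[OF g, of b a] that by auto
    ultimately obtain b where b: "f b a < g b a" "\<And>c. f c a < g c a \<Longrightarrow> c \<le> b"
      using bounded_Max_nat[of "\<lambda>b. f b a < g b a" b0 n] by blast
    have ab: "a < b" using inv_fun_supp[OF g, of b a] b by auto
    \<comment> \<open>A row \<open>c\<close> above \<open>b\<close> separating \<open>a\<close> from
      \<open>b\<close> would give \<open>f c a < f c b \<le> g c b \<le> g c a\<close>, so column
      \<open>a\<close> would also grow in row \<open>c\<close>, contrary to the choice of
      \<open>b\<close>.\<close>
    have "descends f b a"
    proof (rule ccontr)
      assume "\<not> descends f b a"
      then obtain c where c: "b < c" "f c a \<noteq> f c b" using ab by (auto simp: descends_def)
      have "f b a < s b" using b(1) inv_fun_le[OF g, of b a] by simp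
      then have "f c a < f c b" using inv_fun_planar[OF f, of a b c] ab c by auto
      also have "\<dots> \<le> g c b" by (rule le')
      also have "\<dots> \<le> g c a" using inv_fun_trans[OF g, of a b c] ab c b by auto
      finally show False using b(2) c by fastforce
    qed
    then show ?thesis using b by (auto simp: P_def)
  qed
  then obtain b where b: "\<exists>a. P b a" and bmin: "\<And>e a. e < b \<Longrightarrow> \<not> P e a"
    using exists_least_iff[of "\<lambda>b. \<exists>a. P b a"] by blast
  have Plt: "a < b" if "P b a" for a using that by (simp add: P_def descends_def)
  define R where "R a \<longleftrightarrow> P b a \<and> (\<forall>e. a < e \<and> e < b \<and> descends f e a \<longrightarrow> f e a = s e)" for a
  have "\<exists>a. R a"
  proof -
    obtain a where a: "P b a" "\<And>e. P b e \<Longrightarrow> e \<le> a"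
      using b bounded_Max_nat[of "P b" _ b] less_imp_le[OF Plt] by blast
    have "f e a = s e" if e: "a < e" "e < b" "descends f e a" for e
    proof (rule ccontr)
      assume "f e a \<noteq> s e"
      then have lt: "f e a < s e" using inv_fun_le[OF f, of e a] by simp
      \<comment> \<open>By minimality of \<open>b\<close> nothing has grown at
        \<open>(e, a)\<close>, so planarity of \<open>g\<close> passes the growth at
        \<open>(b, a)\<close> on to the larger column \<open>e\<close>.\<close>
      have "g e a = f e a" using bmin[OF e(2), of a] e(3) le'[of e a] by (simp add: P_def)
      then have "g b a \<le> g b e" using inv_fun_planar[OF g, of a e b] e lt by simp
      moreover have "f b e = f b a" using e by (simp add: descends_def)
      moreover have "descends f b e" using descends_between a(1) e by (auto simp: P_def)
      ultimately have "P b e" using a(1) by (simp add: P_def)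
      then show False using a(2)[of e] e(1) by simp
    qed
    then show ?thesis using a by (auto simp: R_def)
  qed
  then obtain a where a: "R a" and amin: "\<And>x. x < a \<Longrightarrow> \<not> R x"
    using exists_least_iff[of R] by blast
  have ab: "descends f b a" "f b a < g b a" using a by (auto simp: R_def P_def)
  have "f a x \<noteq> s a" if pos: "0 < s a" and x0: "descends f a x" for x
  proof
    assume eq0: "f a x = s a"
    \<comment> \<open>Transitivity of \<open>g\<close> passes the growth in row \<open>b\<close>
      from \<open>a\<close> to any vertex in the last child of \<open>a\<close>. The largest
      child-like choice \<open>x\<close> there has no proper ancestor below \<open>a\<close> and
      hence satisfies \<open>R\<close>, against minimality of \<open>a\<close>.\<close>
    let ?Q = "\<lambda>x. descends f a x \<and> f a x = s a"
    have "z \<le> a" if "?Q z" for z using that by (simp add: descends_def)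
    then obtain x where x: "?Q x" and xmax: "\<And>e. ?Q e \<Longrightarrow> e \<le> x"
      using bounded_Max_nat[of ?Q x a] x0 eq0 by blast
    have xa: "x < a" using x by (simp add: descends_def)
    have lt: "a < b" using ab by (simp add: descends_def)
    have "0 < g a x" using x pos le'[of a x] by simp
    then have "g b a \<le> g b x" using inv_fun_trans[OF g, of x a b] lt xa by simp
    moreover have fbx: "f b x = f b a" using x lt by (simp add: descends_def)
    ultimately have "P b x" using descends_trans[OF ab(1)] x ab(2) by (simp add: P_def)
    moreover have "f e x = s e" if e: "x < e" "e < b" "descends f e x" for e
    proof -
      consider "e < a" | "e = a" | "a < e" by linarith
      then show ?thesis
      proof cases
        case 1
        then have "descends f a e" using descends_between x e by blast
        moreover have "f a e = s a" using 1 e x by (simp add: descends_def)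
        ultimately show ?thesis using xmax[of e] e(1) by simp
      next
        case 3
        then have "descends f e a" using descends_between x e by blast
        then have "f e a = s e" using a 3 e by (simp add: R_def)
        then show ?thesis using x 3 by (simp add: descends_def)
      qed (use x in simp)
    qed
    ultimately have "R x" by (simp add: R_def)
    then show False using amin[OF xa] by simp
  qed
  then have "fun_ascent n s f a b"
    using a ab inv_fun_supp[OF g, of b a] inv_fun_le[OF g, of b a]
    by (auto simp: fun_ascent_def R_def)
  then show ?thesis using that ab by blast
qed

subsection \<open>Two ascents\<close>

text \<open>If \<open>x\<close> descends from \<open>d\<close>, the ascent condition applies to
  \<open>d\<close>. Otherwise the positive entry puts \<open>x\<close> to the right of
  \<open>d\<close>, where the entry is maximal anyway.\<close>

lemma ascent_entry_maximal:
  assumes g: "inv_fun n s g" and "x < d" "0 < g d x" and "fun_ascent n s g x y" "d < y"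
  shows "g d x = s d"
proof (cases "descends g d x")
  case True
  then show ?thesis using assms by (auto simp: fun_ascent_def)
next
  case False
  then obtain c where c: "d < c" "g c x \<noteq> g c d" using assms by (auto simp: descends_def)
  then have "g c d < g c x" using inv_fun_trans[OF g, of x d c] assms by simp
  then have "\<not> g d x < s d" using inv_fun_planar[OF g, of x d c] assms c by auto
  then show ?thesis using inv_fun_le[OF g, of d x] by simp
qed

text \<open>
  The pairs whose multiplicity can grow between \<open>f\<close> and the join of its rotations along the
  ascents \<open>(a, b)\<close> and \<open>(a', b')\<close>, where \<open>a' < a\<close>.
\<close>

definition join_changes ::
    "(nat \<Rightarrow> nat \<Rightarrow> nat) \<Rightarrow> nat \<Rightarrow> nat \<Rightarrow> nat \<Rightarrow> nat \<Rightarrow> nat \<Rightarrow> nat \<Rightarrow> bool" where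
  "join_changes f a b a' b' y x \<longleftrightarrow>
     y = b \<and> (x \<in> carried f a \<or> b' = a \<and> x \<in> carried f a') \<or> y = b' \<and> x \<in> carried f a'"

locale two_ascents =
  fixes n s f a b a' b'
  assumes f: "inv_fun n s f" and A: "fun_ascent n s f a b" and A': "fun_ascent n s f a' b'"
    and less: "a' < a"
begin

lemma a_less_b: "a < b" "a' < b'"
  using A A' by (auto simp: fun_ascent_def descends_def)

text \<open>The clause with \<open>b' = a\<close> is needed for closure under composition: raising
  \<open>(a, a')\<close> can turn a zero into a positive entry, after which the vertices carried by
  \<open>a'\<close> also move with \<open>a\<close>.\<close>

lemma join_changes_transitive:
  "transitive_fun (\<lambda>y x. f y x + of_bool (join_changes f a b a' b' y x))"
proof (rule transitive_increment[OF f])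
  fix z x assume "join_changes f a b a' b' z x"
  then show "descends f z x"
    using carried_descends(1)[OF A] carried_descends(1)[OF A']
      descends_trans[OF carried_descends(1)[OF A carried_self], of x]
    by (auto simp: join_changes_def)
next
  fix y z x assume zx: "join_changes f a b a' b' z x" and yz: "join_changes f a b a' b' y z"
  have "a' < z" using zx a_less_b less by (auto simp: join_changes_def)
  then have "z \<notin> carried f a'" using carried_le[of z f a'] by auto
  then have y: "y = b" "z \<in> carried f a" using yz by (auto simp: join_changes_def)
  then have "z \<noteq> b" using carried_le[of z f a] a_less_b by auto
  then have z: "z = b'" "x \<in> carried f a'" using zx by (auto simp: join_changes_def)
  show "join_changes f a b a' b' y x"
  proof (cases "b' = a")
    case False
    \<comment> \<open>Here \<open>b'\<close> is itself carried by \<open>a\<close>, and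
      \<open>x\<close> descends from \<open>b'\<close>, so \<open>f a x = f a b'\<close> is
      positive.\<close>
    then have "b' < a" "0 < f a b'" "descends f a b'"
      using y z by (auto simp: carried_def descends_def)
    moreover have "descends f b' x" using carried_descends[OF A' z(2)] by blast
    ultimately have "x \<in> carried f a"
      using descends_trans[of f a b' x] by (auto simp: carried_def descends_def)
    then show ?thesis using y by (simp add: join_changes_def)
  qed (use y z in \<open>simp add: join_changes_def\<close>)
next
  fix y z x
  assume yz: "join_changes f a b a' b' y z" and x: "x < z" "0 < f z x"
    and yx: "\<not> join_changes f a b a' b' y x"
  consider "y = b" "z \<in> carried f a" | "y = b'" "z \<in> carried f a'"
    | "y = b" "b' = a" "z \<in> carried f a'"
    using yz by (auto simp: join_changes_def)
  then show "f y z < f y x"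
  proof cases
    case 1
    then show ?thesis
      using not_carried_right[OF f A, of z x] carried_descends[OF A, of z] x yx
      by (auto simp: join_changes_def)
  next
    case 2
    then show ?thesis
      using not_carried_right[OF f A', of z x] carried_descends[OF A', of z] x yx
      by (auto simp: join_changes_def)
  next
    case 3
    \<comment> \<open>Two ascents are used in turn: along \<open>(a', a)\<close> the vertex
      \<open>x\<close> gets a positive entry in row \<open>a\<close>, and along
      \<open>(a, b)\<close> this puts it to the right of \<open>a\<close> in row
      \<open>b\<close>.\<close>
    have nx: "x \<notin> carried f a'" "x \<notin> carried f a" using yx 3 by (auto simp: join_changes_def)
    have "f a a' < f a x" using not_carried_right[OF f A' 3(3) x nx(1)] 3 by simp
    moreover have "x < a" using x carried_le[OF 3(3)] less by simp
    ultimately have "f b a < f b x"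
      using not_carried_right[OF f A carried_self _ _ nx(2)] by simp
    moreover have "f b z = f b a"
      using carried_descends[OF A' 3(3)] 3(2) a_less_b by (simp add: descends_def)
    ultimately show ?thesis using 3 by simp
  qed
qed

text \<open>Minimality of \<open>j\<close> is applied to the closure of the maximum of the two
  increments, an upper bound of both rotations. This closure lies below the transitive function of
  \<open>join_changes_transitive\<close>.\<close>

lemma join_le:
  assumes j: "\<And>k. inv_fun n s k \<Longrightarrow> rotate_fun f a b \<le> k \<Longrightarrow> rotate_fun f a' b' \<le> k \<Longrightarrow> j \<le> k"
  shows "j y x \<le> f y x + of_bool (join_changes f a b a' b' y x)"
proof -
  let ?m = "\<lambda>y x. max (add_pair f a b y x) (add_pair f a' b' y x)"
  have B: "bounded_fun n s (add_pair f a b)" "bounded_fun n s (add_pair f a' b')"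
    by (rule add_pair_bounded[OF f A] add_pair_bounded[OF f A'])+
  have "bounded_fun n s ?m"
    unfolding bounded_fun_def
  proof (intro conjI allI impI)
    show "?m y x \<le> s y" for y x using B unfolding bounded_fun_def by (intro max.boundedI) blast+
  next
    fix y x assume "?m y x \<noteq> 0"
    then have "add_pair f a b y x \<noteq> 0 \<or> add_pair f a' b' y x \<noteq> 0" by auto
    then show "1 \<le> x" "x < y" "y \<le> n" using B unfolding bounded_fun_def by blast+
  qed
  moreover have "planar_fun s ?m"
    unfolding planar_fun_def
  proof (intro allI impI)
    fix x z y assume h: "x < z \<and> z < y \<and> ?m z x < s z"
    then have "add_pair f a b z x < s z" "add_pair f a' b' z x < s z" by auto
    then have "add_pair f a b y x \<le> add_pair f a b y z" "add_pair f a' b' y x \<le> add_pair f a' b' y z"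
      using h planar_funD[OF add_pair_planar[OF f A]] planar_funD[OF add_pair_planar[OF f A']] by blast+
    then show "?m y x \<le> ?m y z" by (rule max.mono)
  qed
  ultimately have inv: "inv_fun n s (tc_fun ?m)" by (rule inv_fun_tc)
  have m: "?m y x \<le> tc_fun ?m y x" if "x < y" for y x using tc_fun_ge[OF that, of ?m] by simp
  have "rotate_fun f a b \<le> tc_fun ?m" "rotate_fun f a' b' \<le> tc_fun ?m"
    unfolding rotate_fun_def using m
    by (auto intro!: le_funI tc_fun_least tc_fun_transitive)
  then have "j y x \<le> tc_fun ?m y x" using j[OF inv] by (auto simp: le_fun_def)
  also have "\<dots> \<le> f y x + of_bool (join_changes f a b a' b' y x)"
    by (rule tc_fun_least[OF join_changes_transitive])
      (auto simp: add_pair_def join_changes_def carried_self)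
  finally show ?thesis .
qed

text \<open>The entry \<open>(y, x)\<close> has room to grow, so \<open>x\<close> is carried by
  \<open>d = a\<close> or \<open>d = a'\<close>. If \<open>x\<close> differs from \<open>d\<close>,
  the ascent of \<open>g\<close> forces \<open>g d x = s d\<close>, whereas \<open>f d x\<close> was
  smaller. So the pair \<open>(d, x)\<close> must have changed, which the bound rules out.\<close>

lemma label_in_interval:
  assumes j: "\<And>y x. j y x \<le> f y x + of_bool (join_changes f a b a' b' y x)"
    and g: "inv_fun n s g" "f \<le> g" "fun_ascent n s g x y" "rotate_fun g x y \<le> j"
  shows "x = a \<or> x = a'"
proof (rule ccontr)
  assume nx: "\<not> (x = a \<or> x = a')"
  have fg: "f p q \<le> g p q" for p q using g(2) by (simp add: le_fun_def)
  have gj: "g p q \<le> j p q" for p q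
    using order_trans[OF rotate_fun_ge[OF g(1)] g(4)] by (simp add: le_fun_def)
  have "x < y" using g(3) by (simp add: fun_ascent_def descends_def)
  then have "g y x < j y x"
    using less_le_trans[OF rotate_fun_increases] le_funD[OF le_funD[OF g(4)]] by blast
  then have "join_changes f a b a' b' y x" using fg[of y x] j[of y x]
    by (cases "join_changes f a b a' b' y x") auto
  then have "b \<le> y \<and> x \<in> carried f a \<or> b' \<le> y \<and> x \<in> carried f a'"
    using a_less_b unfolding join_changes_def by fastforce
  moreover have *: False if "b' \<le> y" "x \<in> carried f a'"
  proof -
    have c: "x < a'" "0 < f a' x" "f a' x < s a'" using carried_less[OF f A'] that nx by auto
    then have "g a' x = s a'"
      using ascent_entry_maximal[OF g(1) c(1) _ g(3)] that a_less_b fg[of a' x] by auto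
    then have "join_changes f a b a' b' a' x" using c gj[of a' x] j[of a' x]
      by (cases "join_changes f a b a' b' a' x") auto
    then show False using a_less_b less by (auto simp: join_changes_def)
  qed
  moreover have False if "b \<le> y" "x \<in> carried f a"
  proof -
    have c: "x < a" "0 < f a x" "f a x < s a" using carried_less[OF f A] that nx by auto
    then have "g a x = s a"
      using ascent_entry_maximal[OF g(1) c(1) _ g(3)] that a_less_b fg[of a x] by auto
    then have "join_changes f a b a' b' a x" using c gj[of a x] j[of a x]
      by (cases "join_changes f a b a' b' a x") auto
    \<comment> \<open>Since \<open>a < b\<close>, the only remaining possibility is
      \<open>b' = a\<close> with \<open>x\<close> carried by \<open>a'\<close>. This is the case
      already excluded, because \<open>a\<close> is below \<open>y\<close>.\<close>
    then show False using * that a_less_b by (auto simp: join_changes_def)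
  qed
  ultimately show False by blast
qed

end

subsection \<open>Trees\<close>

text \<open>The vertex set is left free so that the property passes to subtrees and supports
  induction.\<close>

definition s_tree :: "(nat \<Rightarrow> nat) \<Rightarrow> ltree \<Rightarrow> bool" where
  "s_tree s T \<longleftrightarrow> distinct (labels T) \<and>
     (\<forall>i ts. Node i ts \<in> subtrees T \<longrightarrow>
        length ts = s i + 1 \<and> (\<forall>t\<in>set ts. \<forall>x\<in>set (labels t). x < i))"

abbreviation vertices :: "ltree \<Rightarrow> nat set" where
  "vertices T \<equiv> set (labels T)"

lemma s_decreasing_tree_iff: "s_decreasing_tree n s T \<longleftrightarrow> s_tree s T \<and> vertices T = {1..n}"
  by (auto simp: s_decreasing_tree_def s_tree_def)

lemma set_conv_image_nth: "set xs = (!) xs ` {..<length xs}"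
  by (auto simp: set_conv_nth)

lemma distinct_concat_nth:
  "distinct (concat xss) \<longleftrightarrow> (\<forall>xs\<in>set xss. distinct xs) \<and>
     (\<forall>k<length xss. \<forall>j<k. set (xss ! j) \<inter> set (xss ! k) = {})"
proof (induction xss)
  case (Cons xs xss)
  have "(\<forall>k<length (xs # xss). \<forall>j<k. set ((xs # xss) ! j) \<inter> set ((xs # xss) ! k) = {}) \<longleftrightarrow>
      (\<forall>k<length xss. set xs \<inter> set (xss ! k) = {}) \<and>
      (\<forall>k<length xss. \<forall>j<k. set (xss ! j) \<inter> set (xss ! k) = {})"
    by (simp only: length_Cons All_less_Suc2) (simp, blast)
  moreover have "set xs \<inter> set (concat xss) = {} \<longleftrightarrow> (\<forall>k<length xss. set xs \<inter> set (xss ! k) = {})"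
    by (auto simp: set_conv_image_nth[of xss])
  ultimately show ?case using Cons.IH by (simp only: concat.simps distinct_append list.set ball_simps) blast
qed simp

lemma s_tree_Leaf: "s_tree s Leaf"
  by (simp add: s_tree_def)

lemma s_tree_Node:
  "s_tree s (Node r ts) \<longleftrightarrow> length ts = s r + 1 \<and>
     (\<forall>t\<in>set ts. s_tree s t \<and> (\<forall>x\<in>vertices t. x < r)) \<and>
     (\<forall>k<length ts. \<forall>j<k. vertices (ts ! j) \<inter> vertices (ts ! k) = {})" (is "?L \<longleftrightarrow> ?R")
proof
  assume L: ?L
  then have "s_tree s t" if "t \<in> set ts" for t
    using that split_list[OF that] unfolding s_tree_def by fastforce
  with L show ?R
    unfolding s_tree_def[of s "Node r ts"] by (simp add: distinct_concat_nth)
next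
  assume R: ?R
  then have "distinct (labels (Node r ts))"
    by (auto simp: distinct_concat_nth s_tree_def)
  with R show ?L unfolding s_tree_def by auto
qed

lemma vertices_Node: "vertices (Node r ts) = insert r (\<Union>k<length ts. vertices (ts ! k))"
  by (simp add: set_conv_image_nth[of ts])

declare labels.simps(2) [simp del]

lemma subtrees_vertices: "t \<in> subtrees T \<Longrightarrow> vertices t \<subseteq> vertices T"
  by (induction T rule: subtrees.induct) (auto simp: labels.simps)

lemma in_child_alt:
  "in_child T z j x \<longleftrightarrow> (\<exists>ts. Node z ts \<in> subtrees T \<and> j < length ts \<and> x \<in> vertices (ts ! j))"
  by (auto simp: in_child_def child_subtree_def)

lemma in_child_vertices:
  assumes "in_child T z j x"
  shows "z \<in> vertices T" "x \<in> vertices T"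
proof -
  obtain ts where ts: "Node z ts \<in> subtrees T" "j < length ts" "x \<in> vertices (ts ! j)"
    using assms by (auto simp: in_child_alt)
  then have "x \<in> vertices (Node z ts)" "z \<in> vertices (Node z ts)" by (auto simp: vertices_Node)
  then show "z \<in> vertices T" "x \<in> vertices T" using subtrees_vertices[OF ts(1)] by auto
qed

lemma in_child_Node:
  "in_child (Node r ts) z j x \<longleftrightarrow>
     z = r \<and> j < length ts \<and> x \<in> vertices (ts ! j) \<or> (\<exists>k<length ts. in_child (ts ! k) z j x)"
proof -
  have "Node z us \<in> subtrees (Node r ts) \<longleftrightarrow>
      z = r \<and> us = ts \<or> (\<exists>k<length ts. Node z us \<in> subtrees (ts ! k))" for us
    by (auto simp: set_conv_image_nth[of ts])
  then show ?thesis by (auto simp: in_child_alt)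
qed

section \<open>Cardinalities computed by splitting a tree at its root\<close>

locale s_tree_node =
  fixes s r ts
  assumes node: "s_tree s (Node r ts)"
begin

lemma length_children: "length ts = s r + 1"
  using node by (simp add: s_tree_Node)

lemma child_s_tree: "k < length ts \<Longrightarrow> s_tree s (ts ! k)"
  using node by (simp add: s_tree_Node)

lemma child_less: "k < length ts \<Longrightarrow> x \<in> vertices (ts ! k) \<Longrightarrow> x < r"
  using node nth_mem unfolding s_tree_Node by blast

lemma child_unique:
  assumes "j < length ts" "k < length ts" "x \<in> vertices (ts ! j)" "x \<in> vertices (ts ! k)"
  shows "j = k"
  using node assms unfolding s_tree_Node by (metis disjoint_iff nat_neq_iff)

lemma in_child_root:
  assumes "j < length ts" "x \<in> vertices (ts ! j)"
  shows "in_child (Node r ts) r i x \<longleftrightarrow> i = j"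
  unfolding in_child_Node
  using assms child_unique[of i j x] in_child_vertices(1)[of "ts ! _" r i x] child_less[of _ r] by blast

lemma in_child_child:
  assumes "k < length ts" "y \<in> vertices (ts ! k)"
  shows "in_child (Node r ts) y i x \<longleftrightarrow> in_child (ts ! k) y i x"
  unfolding in_child_Node
  using assms child_unique[of _ k y] in_child_vertices(1)[of "ts ! _" y i x] child_less[of k y] by blast

lemma not_in_child_root: "\<not> in_child (Node r ts) z i r"
  unfolding in_child_Node using in_child_vertices(2)[of "ts ! _" z i r] child_less[of _ r] by blast

lemma left_of_different:
  assumes "j < length ts" "k < length ts" "x \<in> vertices (ts ! j)" "y \<in> vertices (ts ! k)" "j \<noteq> k"
  shows "left_of (Node r ts) x y \<longleftrightarrow> j < k"
proof
  assume "left_of (Node r ts) x y"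
  then obtain z p q where z: "p < q" "in_child (Node r ts) z p x" "in_child (Node r ts) z q y"
    by (auto simp: left_of_def)
  show "j < k"
  proof (cases "z = r")
    case True
    then show ?thesis using z in_child_root assms by simp
  next
    case False
    then obtain l where l: "l < length ts" "z \<in> vertices (ts ! l)"
      using in_child_vertices(1)[OF z(2)] by (auto simp: vertices_Node)
    then have "x \<in> vertices (ts ! l)" "y \<in> vertices (ts ! l)"
      using z in_child_child[OF l] in_child_vertices(2) by blast+
    then show ?thesis using child_unique assms l by blast
  qed
next
  assume "j < k"
  then show "left_of (Node r ts) x y"
    unfolding left_of_def using in_child_root assms by blast
qed

lemma left_of_same:
  assumes k: "k < length ts" "x \<in> vertices (ts ! k)" "y \<in> vertices (ts ! k)"
  shows "left_of (Node r ts) x y \<longleftrightarrow> left_of (ts ! k) x y"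
proof
  assume "left_of (Node r ts) x y"
  then obtain z p q where z: "p < q" "in_child (Node r ts) z p x" "in_child (Node r ts) z q y"
    by (auto simp: left_of_def)
  have "z \<noteq> r" using z in_child_root k by fastforce
  then obtain l where l: "l < length ts" "z \<in> vertices (ts ! l)"
    using in_child_vertices(1)[OF z(2)] by (auto simp: vertices_Node)
  then have "x \<in> vertices (ts ! l)" using z(2) in_child_child[OF l] in_child_vertices(2) by blast
  then have "l = k" using child_unique k l by blast
  then show "left_of (ts ! k) x y" using z in_child_child[OF l] by (auto simp: left_of_def)
next
  assume "left_of (ts ! k) x y"
  then show "left_of (Node r ts) x y" unfolding left_of_def in_child_Node using k by blast
qed

lemma tree_card_root:
  assumes "j < length ts" "x \<in> vertices (ts ! j)"
  shows "tree_card s (Node r ts) r x = j"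
proof -
  have "\<not> left_of (Node r ts) x r" "\<not> left_of (Node r ts) r x"
    using not_in_child_root by (auto simp: left_of_def)
  then show ?thesis
    using assms length_children unfolding tree_card_def in_child_root[OF assms]
    by (auto intro: the_equality)
qed

lemma tree_card_different:
  assumes "j < length ts" "k < length ts" "x \<in> vertices (ts ! j)" "y \<in> vertices (ts ! k)" "j \<noteq> k"
  shows "tree_card s (Node r ts) y x = (if j < k then 0 else s y)"
proof -
  have "\<not> in_child (Node r ts) y i x" for i
    using in_child_child[of k y i x] in_child_vertices(2)[of "ts ! k" y i x] child_unique assms
    by blast
  then show ?thesis
    using left_of_different[OF assms] left_of_different[OF assms(2,1,4,3)] assms(5)
    by (auto simp: tree_card_def)
qed

lemma tree_card_same:
  assumes "k < length ts" "x \<in> vertices (ts ! k)" "y \<in> vertices (ts ! k)"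
  shows "tree_card s (Node r ts) y x = tree_card s (ts ! k) y x"
  using assms unfolding tree_card_def by (simp add: in_child_child left_of_same)

lemma vertex_cases:
  assumes "x \<in> vertices (Node r ts)"
  obtains "x = r" | k where "k < length ts" "x \<in> vertices (ts ! k)" "x < r"
  using assms child_less by (auto simp: vertices_Node)

lemma vertices_child:
  assumes "k < length ts"
  shows "vertices (ts ! k) = {x \<in> vertices (Node r ts). x \<noteq> r \<and> tree_card s (Node r ts) r x = k}"
  using assms child_less tree_card_root by (fastforce simp: vertices_Node)

end

lemma tree_card_le:
  "s_tree s T \<Longrightarrow> x \<in> vertices T \<Longrightarrow> y \<in> vertices T \<Longrightarrow> x < y \<Longrightarrow> tree_card s T y x \<le> s y"
proof (induction T)
  case (Node r ts)
  interpret s_tree_node s r ts using Node by unfold_locales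
  have x: "x \<noteq> r" using Node.prems(3,4) by (auto elim: vertex_cases)
  then obtain j where j: "j < length ts" "x \<in> vertices (ts ! j)"
    using Node.prems(2) by (auto elim: vertex_cases)
  show ?case
  proof (cases rule: vertex_cases[OF Node.prems(3)])
    case 1
    then show ?thesis using tree_card_root[OF j] j length_children by simp
  next
    case (2 k)
    then show ?thesis
      using tree_card_different[OF j(1) 2(1) j(2) 2(2)] tree_card_same[OF 2(1) _ 2(2)] j
        Node.IH[of "ts ! k"] child_s_tree Node.prems(4) by (cases "j = k") auto
  qed
qed simp

text \<open>By induction, only triples not contained in one child of the root matter. For these the
  entries are child indices in the row of the root, or the extreme values 0 and \<open>s\<close> for
  vertices in different children.\<close>

lemma tree_card_transitive_planar:
  assumes "s_tree s T" "{x, z, y} \<subseteq> vertices T" "x < z" "z < y"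
  shows "(0 < tree_card s T z x \<longrightarrow> tree_card s T y z \<le> tree_card s T y x) \<and>
    (tree_card s T z x < s z \<longrightarrow> tree_card s T y x \<le> tree_card s T y z)"
  using assms
proof (induction T)
  case (Node r ts)
  interpret s_tree_node s r ts using Node by unfold_locales
  have y: "y \<in> vertices (Node r ts)" using Node.prems by auto
  have zr: "x \<noteq> r" "z \<noteq> r" using Node.prems(3,4) y by (auto elim: vertex_cases)
  obtain j where j: "j < length ts" "x \<in> vertices (ts ! j)"
    using Node.prems(2) zr by (auto elim: vertex_cases)
  obtain l where l: "l < length ts" "z \<in> vertices (ts ! l)"
    using Node.prems(2) zr by (auto elim: vertex_cases)
  note zx = tree_card_different[OF j(1) l(1) j(2) l(2)]
  show ?case
  proof (cases rule: vertex_cases[OF y])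
    case 1
    then show ?thesis using tree_card_root[OF j] tree_card_root[OF l] zx by (cases "j = l") auto
  next
    case (2 k)
    note yx = tree_card_different[OF j(1) 2(1) j(2) 2(2)]
    note yz = tree_card_different[OF l(1) 2(1) l(2) 2(2)]
    consider "l = k" "j = k" | "l = k" "j \<noteq> k" | "l \<noteq> k" by blast
    then show ?thesis
    proof cases
      case a: 1
      then show ?thesis
        using Node.IH[of "ts ! k"] tree_card_same[OF 2(1)] child_s_tree 2 j l Node.prems(3,4) by auto
    next
      case b: 2
      have "tree_card s (Node r ts) y z \<le> s y"
        using tree_card_le[OF Node.prems(1)] Node.prems by auto
      then show ?thesis using b yx zx by auto
    next
      case c: 3
      have "tree_card s (Node r ts) y x \<le> s y"
        using tree_card_le[OF Node.prems(1)] Node.prems by auto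
      then show ?thesis using c yx yz zx by (cases "j = k"; cases "j = l") (auto split: if_splits)
    qed
  qed
qed simp

text \<open>This recovers the ancestor relation from cardinalities alone. If \<open>x\<close> and
  \<open>y\<close> lie in different children of the root, the row of the root separates them;
  otherwise the claim reduces to their common child.\<close>

lemma in_child_iff:
  assumes "s_tree s T" "x \<in> vertices T" "y \<in> vertices T"
  shows "in_child T y i x \<longleftrightarrow> x < y \<and> tree_card s T y x = i \<and>
    (\<forall>c\<in>vertices T. y < c \<longrightarrow> tree_card s T c x = tree_card s T c y)"
  using assms
proof (induction T)
  case (Node r ts)
  interpret s_tree_node s r ts using Node by unfold_locales
  have le: "c \<le> r" if "c \<in> vertices (Node r ts)" for c using that by (auto elim: vertex_cases)
  show ?case
  proof (cases "x = r")
    case True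
    then show ?thesis using not_in_child_root le Node.prems(3) by fastforce
  next
    case False
    then obtain j where j: "j < length ts" "x \<in> vertices (ts ! j)" "x < r"
      using Node.prems(2) by (auto elim: vertex_cases)
    show ?thesis
    proof (cases rule: vertex_cases[OF Node.prems(3)])
      case 1
      then show ?thesis using in_child_root[OF j(1,2)] tree_card_root[OF j(1,2)] le j(3) by fastforce
    next
      case (2 k)
      show ?thesis
      proof (cases "j = k")
        case False
        then have "tree_card s (Node r ts) r x \<noteq> tree_card s (Node r ts) r y"
          using tree_card_root[OF j(1,2)] tree_card_root[OF 2(1,2)] by simp
        moreover have "\<not> in_child (Node r ts) y i x"
          using in_child_child[OF 2(1,2)] in_child_vertices(2)[of "ts ! k" y i x] child_unique j 2 False
          by blast
        ultimately show ?thesis using 2(3) by (auto simp: vertices_Node)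
      next
        case True
        \<comment> \<open>A vertex outside the common child cannot distinguish \<open>x\<close> from
          \<open>y\<close>, so no new condition arises on passing from the child to the whole
          tree.\<close>
        have eq: "tree_card s (Node r ts) c x = tree_card s (Node r ts) c y"
          if "c \<in> vertices (Node r ts)" "c \<notin> vertices (ts ! k)" for c
        proof (cases rule: vertex_cases[OF that(1)])
          case 1
          then show ?thesis using tree_card_root[OF j(1,2)] tree_card_root[OF 2(1,2)] True by simp
        next
          case l: (2 l)
          then have "l \<noteq> k" using that by auto
          then show ?thesis
            using tree_card_different[OF 2(1) l(1) 2(2) l(2)] tree_card_different[OF j(1) l(1) j(2) l(2)]
              True by simp
        qed
        have sub: "vertices (ts ! k) \<subseteq> vertices (Node r ts)" using 2 by (auto simp: vertices_Node)
        have same: "tree_card s (Node r ts) c x = tree_card s (ts ! k) c x"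
          "tree_card s (Node r ts) c y = tree_card s (ts ! k) c y" if "c \<in> vertices (ts ! k)" for c
          using tree_card_same 2 j True that by auto
        have "in_child (Node r ts) y i x \<longleftrightarrow> in_child (ts ! k) y i x" by (rule in_child_child[OF 2(1,2)])
        also have "\<dots> \<longleftrightarrow> x < y \<and> tree_card s (ts ! k) y x = i \<and>
            (\<forall>c\<in>vertices (ts ! k). y < c \<longrightarrow> tree_card s (ts ! k) c x = tree_card s (ts ! k) c y)"
          using Node.IH[of "ts ! k"] child_s_tree j 2 True by simp
        also have "\<dots> \<longleftrightarrow> x < y \<and> tree_card s (Node r ts) y x = i \<and>
            (\<forall>c\<in>vertices (Node r ts). y < c \<longrightarrow>
               tree_card s (Node r ts) c x = tree_card s (Node r ts) c y)"
        proof -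
          have "tree_card s (ts ! k) c x = tree_card s (ts ! k) c y \<longleftrightarrow>
              tree_card s (Node r ts) c x = tree_card s (Node r ts) c y" if "c \<in> vertices (ts ! k)" for c
            unfolding same[OF that] ..
          then have "(\<forall>c\<in>vertices (ts ! k). y < c \<longrightarrow> tree_card s (ts ! k) c x = tree_card s (ts ! k) c y) \<longleftrightarrow>
              (\<forall>c\<in>vertices (Node r ts). y < c \<longrightarrow>
                 tree_card s (Node r ts) c x = tree_card s (Node r ts) c y)"
            using eq sub by blast
          then show ?thesis unfolding same(1)[OF 2(2)] by blast
        qed
        finally show ?thesis .
      qed
    qed
  qed
qed simp

text \<open>The root is the largest label, and its row of cardinalities determines which vertices
  belong to each child. The children agree by induction.\<close>

lemma s_tree_eqI:
  assumes "s_tree s T" "s_tree s T'" "vertices T = vertices T'"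
    and "\<And>x y. x \<in> vertices T \<Longrightarrow> y \<in> vertices T \<Longrightarrow> x < y \<Longrightarrow> tree_card s T y x = tree_card s T' y x"
  shows "T = T'"
  using assms
proof (induction T arbitrary: T')
  case Leaf
  then show ?case by (cases T') (auto simp: labels.simps)
next
  case (Node r ts)
  then obtain r' ts' where T': "T' = Node r' ts'" by (cases T') (auto simp: labels.simps)
  interpret L: s_tree_node s r ts using Node by unfold_locales
  interpret R: s_tree_node s r' ts' using Node T' by unfold_locales auto
  have "r \<in> vertices (Node r' ts')" "r' \<in> vertices (Node r ts)" 
    using Node.prems(3) T' by (auto simp: labels.simps)
  then have "r \<le> r'" "r' \<le> r" by (auto elim: L.vertex_cases R.vertex_cases)
  then have r: "r' = r" by simp
  have len: "length ts' = length ts" using L.length_children R.length_children r by simp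
  have V: "vertices (Node r ts) = vertices (Node r ts')" using Node.prems(3) T' r by simp
  have vk: "vertices (ts ! k) = vertices (ts' ! k)" if "k < length ts" for k
  proof -
    have "tree_card s (Node r ts) r x = tree_card s (Node r ts') r x"
      if "x \<in> vertices (Node r ts)" "x \<noteq> r" for x
    proof -
      have "x < r" using that by (auto elim: L.vertex_cases)
      then show ?thesis using Node.prems(4)[of x r] that T' r by (simp add: vertices_Node)
    qed
    then show ?thesis
      using L.vertices_child[of k] R.vertices_child[of k] that len r V by auto
  qed
  have "ts ! k = ts' ! k" if k: "k < length ts" for k
  proof (rule Node.IH[of "ts ! k"])
    show "s_tree s (ts ! k)" "s_tree s (ts' ! k)"
      using L.child_s_tree R.child_s_tree k len by auto
    fix x y assume xy: "x \<in> vertices (ts ! k)" "y \<in> vertices (ts ! k)" "x < y"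
    have "tree_card s (Node r ts) y x = tree_card s (Node r ts') y x"
      using Node.prems(4)[of x y] xy k T' r by (auto simp: vertices_Node)
    then show "tree_card s (ts ! k) y x = tree_card s (ts' ! k) y x"
      using L.tree_card_same[OF k xy(1,2)] R.tree_card_same[of k x y] xy k len vk r by simp
  qed (use k vk in auto)
  then show ?case using T' r len by (auto intro: nth_equalityI)
qed

text \<open>The tree is built from the top: the maximum \<open>r\<close> becomes the root and child
  \<open>k\<close> receives the vertices \<open>x\<close> with \<open>f r x = k\<close>.
  Transitivity and planarity force exactly the extreme entries that a tree gives to vertices in
  different children.\<close>

lemma s_tree_exists:
  assumes "finite V" and le: "\<And>y x. f y x \<le> s y" and tr: "transitive_fun f" and pl: "planar_fun s f"
  shows "\<exists>T. s_tree s T \<and> vertices T = V \<and> (\<forall>x\<in>V. \<forall>y\<in>V. x < y \<longrightarrow> tree_card s T y x = f y x)"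
  using assms(1)
proof (induction V rule: finite_psubset_induct)
  case (psubset V)
  show ?case
  proof (cases "V = {}")
    case True
    then show ?thesis by (intro exI[of _ Leaf]) (simp add: s_tree_Leaf)
  next
    case False
    define r where "r = Max V"
    define W where "W k = {x \<in> V. x \<noteq> r \<and> f r x = k}" for k
    have r: "r \<in> V" using psubset(1) False by (simp add: r_def)
    have lt: "x < r" if "x \<in> V" "x \<noteq> r" for x
      using that psubset(1) Max_ge[of V x] by (simp add: r_def order_le_neq_trans)
    have "\<exists>T. s_tree s T \<and> vertices T = W k \<and>
        (\<forall>x\<in>W k. \<forall>y\<in>W k. x < y \<longrightarrow> tree_card s T y x = f y x)" for k
      using r by (intro psubset.IH) (auto simp: W_def)
    then obtain t where t: "\<And>k. s_tree s (t k)" "\<And>k. vertices (t k) = W k"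
      "\<And>k x y. x \<in> W k \<Longrightarrow> y \<in> W k \<Longrightarrow> x < y \<Longrightarrow> tree_card s (t k) y x = f y x"
      by metis
    define ts where "ts = map t [0..<s r + 1]"
    have nth: "ts ! k = t k" if "k < length ts" for k using that by (simp add: ts_def del: upt_Suc)
    have len: "length ts = s r + 1" by (simp add: ts_def)
    interpret s_tree_node s r ts
    proof
      have "s_tree s u \<and> (\<forall>x\<in>vertices u. x < r)" if "u \<in> set ts" for u
        using that t lt by (auto simp: ts_def W_def)
      moreover have "vertices (ts ! j) \<inter> vertices (ts ! k) = {}" if "k < length ts" "j < k" for j k
        using that nth t by (auto simp: W_def)
      ultimately show "s_tree s (Node r ts)" using len by (simp add: s_tree_Node)
    qed
    have V: "vertices (Node r ts) = V"
      using r le[of r] by (auto simp: vertices_Node nth t W_def len less_Suc_eq_le)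
    have "tree_card s (Node r ts) y x = f y x" if xy: "x \<in> V" "y \<in> V" "x < y" for x y
    proof -
      have xr: "x < r" using lt xy by (cases "y = r") fastforce+
      have j: "f r x < length ts" "x \<in> vertices (ts ! f r x)"
        using xy xr le[of r x] nth t len by (auto simp: W_def)
      show ?thesis
      proof (cases "y = r")
        case True
        then show ?thesis using tree_card_root[OF j] by simp
      next
        case False
        then have yr: "y < r" using lt xy by blast
        have k: "f r y < length ts" "y \<in> vertices (ts ! f r y)"
          using xy yr le[of r y] nth t len by (auto simp: W_def)
        consider "f r x = f r y" | "f r x < f r y" | "f r y < f r x" by linarith
        then show ?thesis
        proof cases
          case 1
          then show ?thesis using tree_card_same[OF k(1) _ k(2), of x] j k nth t xy by simp
        next
          case 2
          \<comment> \<open>If \<open>x\<close> is left of \<open>y\<close>, a positive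
            \<open>f y x\<close> would by transitivity give \<open>f r y \<le> f r x\<close>. The
            next case is the mirror image, by planarity.\<close>
          then have "f y x = 0" using transitive_funD[OF tr, of x y r] xy yr by fastforce
          then show ?thesis using tree_card_different[OF j(1) k(1) j(2) k(2)] 2 by simp
        next
          case 3
          then have "\<not> f y x < s y" using planar_funD[OF pl, of x y r] xy yr by fastforce
          then have "f y x = s y" using le[of y x] by simp
          then show ?thesis using tree_card_different[OF j(1) k(1) j(2) k(2)] 3 by simp
        qed
      qed
    qed
    then show ?thesis using node V by blast
  qed
qed

section \<open>Leaves in terms of child membership\<close>

lemma subtree_exists: "a \<in> vertices T \<Longrightarrow> \<exists>ts. Node a ts \<in> subtrees T"
  by (induction T rule: subtrees.induct) (auto simp: labels.simps, blast)

lemma subtree_unique: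
  "s_tree s T \<Longrightarrow> Node a us \<in> subtrees T \<Longrightarrow> Node a vs \<in> subtrees T \<Longrightarrow> us = vs"
proof (induction T)
  case (Node r ts)
  interpret s_tree_node s r ts using Node by unfold_locales
  have split: "a = r \<and> ws = ts \<or> (\<exists>k<length ts. Node a ws \<in> subtrees (ts ! k))"
    if "Node a ws \<in> subtrees (Node r ts)" for ws
    using that by (auto simp: set_conv_image_nth[of ts])
  have root: "a \<in> vertices (ts ! k) \<and> a < r" if "Node a ws \<in> subtrees (ts ! k)" "k < length ts" for ws k
    using subtrees_vertices[OF that(1)] child_less[OF that(2)] by (auto simp: vertices_Node)
  show ?case
  proof (cases "a = r")
    case True
    then show ?thesis using split[OF Node.prems(2)] split[OF Node.prems(3)] root by blast
  next
    case False
    then obtain j k where j: "j < length ts" "Node a us \<in> subtrees (ts ! j)"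
      and k: "k < length ts" "Node a vs \<in> subtrees (ts ! k)"
      using split[OF Node.prems(2)] split[OF Node.prems(3)] by blast
    then have "j = k" using child_unique root by blast
    then show ?thesis using Node.IH[of "ts ! k"] child_s_tree j k by simp
  qed
qed simp

lemma child_subtree_Leaf_iff:
  assumes T: "s_tree s T" and a: "a \<in> vertices T"
  shows "child_subtree T a (s a) Leaf \<longleftrightarrow> (\<forall>x. \<not> in_child T a (s a) x)"
proof -
  obtain ts where ts: "Node a ts \<in> subtrees T" using subtree_exists[OF a] by blast
  then have len: "length ts = s a + 1" using T by (simp add: s_tree_def)
  have uniq: "Node a us \<in> subtrees T \<longleftrightarrow> us = ts" for us using subtree_unique[OF T] ts by blast
  have "ts ! s a = Leaf \<longleftrightarrow> vertices (ts ! s a) = {}" by (cases "ts ! s a") (auto simp: labels.simps)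
  moreover have "child_subtree T a (s a) Leaf \<longleftrightarrow> ts ! s a = Leaf"
    unfolding child_subtree_def uniq using len by auto
  moreover have "in_child T a (s a) x \<longleftrightarrow> x \<in> vertices (ts ! s a)" for x
    unfolding in_child_alt uniq using len by auto
  ultimately show ?thesis by auto
qed

subsection \<open>Inversion sets of trees\<close>

definition inv_count :: "nat \<Rightarrow> (nat \<Rightarrow> nat) \<Rightarrow> ltree \<Rightarrow> nat \<Rightarrow> nat \<Rightarrow> nat" where
  "inv_count n s T y x = count (tree_inv n s T) (y, x)"

lemma finite_inv_pairs: "finite (inv_pairs n)"
  by (rule finite_subset[of _ "{..n} \<times> {..n}"]) (auto simp: inv_pairs_def)

lemma count_sum_replicate:
  assumes "finite A"
  shows "count (\<Sum>(y, x)\<in>A. replicate_mset (g y x) (y, x)) (p, q) = (if (p, q) \<in> A then g p q else 0)"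
proof -
  have "count (\<Sum>(y, x)\<in>A. replicate_mset (g y x) (y, x)) (p, q) =
      (\<Sum>z\<in>A. if (p, q) = z then g p q else 0)"
    unfolding count_sum by (rule sum.cong) (auto split: prod.splits)
  then show ?thesis using assms by simp
qed

lemma inv_count_eq:
  "inv_count n s T y x = (if 1 \<le> x \<and> x < y \<and> y \<le> n then tree_card s T y x else 0)"
  unfolding inv_count_def tree_inv_def count_sum_replicate[OF finite_inv_pairs]
  by (simp add: inv_pairs_def)

lemma tree_inv_subseteq_iff: "tree_inv n s T \<subseteq># tree_inv n s Z \<longleftrightarrow> inv_count n s T \<le> inv_count n s Z"
  by (auto simp: subseteq_mset_def inv_count_def le_fun_def)

lemma tree_inv_eq_iff:
  "tree_inv n s Z = I \<longleftrightarrow> inv_count n s Z = (\<lambda>y x. count I (y, x))"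
  by (auto simp: multiset_eq_iff inv_count_def fun_eq_iff)

lemma inv_fun_inv_count:
  assumes "s_decreasing_tree n s T"
  shows "inv_fun n s (inv_count n s T)"
proof -
  have T: "s_tree s T" "vertices T = {1..n}" using assms by (auto simp: s_decreasing_tree_iff)
  have "bounded_fun n s (inv_count n s T)"
    unfolding bounded_fun_def inv_count_eq using tree_card_le[OF T(1)] T(2) by simp
  moreover have "transitive_fun (inv_count n s T)"
    unfolding transitive_fun_def
  proof (intro allI impI)
    fix x z y assume "x < z \<and> z < y \<and> 0 < inv_count n s T z x"
    then show "inv_count n s T y z \<le> inv_count n s T y x"
      using tree_card_transitive_planar[OF T(1), of x z y] T(2)
      by (auto simp: inv_count_eq split: if_splits)
  qed
  moreover have "planar_fun s (inv_count n s T)"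
    unfolding planar_fun_def
  proof (intro allI impI)
    fix x z y assume "x < z \<and> z < y \<and> inv_count n s T z x < s z"
    then show "inv_count n s T y x \<le> inv_count n s T y z"
      using tree_card_transitive_planar[OF T(1), of x z y] T(2)
      by (auto simp: inv_count_eq split: if_splits)
  qed
  ultimately show ?thesis by (simp add: inv_fun_def)
qed

lemma inv_fun_tree:
  assumes f: "inv_fun n s f"
  obtains T where "s_decreasing_tree n s T" "inv_count n s T = f"
proof -
  obtain T where T: "s_tree s T" "vertices T = {1..n}"
    "\<And>x y. x \<in> {1..n} \<Longrightarrow> y \<in> {1..n} \<Longrightarrow> x < y \<Longrightarrow> tree_card s T y x = f y x"
    using s_tree_exists[of "{1..n}" f s] f inv_fun_le[OF f] unfolding inv_fun_def by auto
  have "inv_count n s T y x = f y x" for y x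
    using T(3)[of x y] inv_fun_supp[OF f, of y x] by (cases "f y x = 0") (auto simp: inv_count_eq)
  then show ?thesis using that T by (auto simp: s_decreasing_tree_iff fun_eq_iff)
qed

lemma inv_count_inj:
  assumes "s_decreasing_tree n s T" "s_decreasing_tree n s Z" and eq: "inv_count n s T = inv_count n s Z"
  shows "T = Z"
proof (rule s_tree_eqI)
  show "s_tree s T" "s_tree s Z" "vertices T = vertices Z"
    using assms by (auto simp: s_decreasing_tree_iff)
  fix x y assume "x \<in> vertices T" "y \<in> vertices T" "x < y"
  then show "tree_card s T y x = tree_card s Z y x"
    using fun_cong[OF fun_cong[OF eq], of y x] assms(1)
    by (simp add: inv_count_eq s_decreasing_tree_iff)
qed

text \<open>The bounds on \<open>a\<close> and \<open>b\<close> restrict the relation to vertices of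
  the tree: for positive \<open>n\<close>, \<open>descends\<close> holds between \<open>n\<close>
  and 0, since all rows above \<open>n\<close> vanish.\<close>

lemma in_child_iff_descends:
  assumes T: "s_decreasing_tree n s T"
  shows "in_child T b i a \<longleftrightarrow>
    1 \<le> a \<and> b \<le> n \<and> descends (inv_count n s T) b a \<and> inv_count n s T b a = i"
proof (cases "1 \<le> a \<and> a < b \<and> b \<le> n")
  case True
  have "s_tree s T" "vertices T = {1..n}" using T by (auto simp: s_decreasing_tree_iff)
  then show ?thesis
    using True in_child_iff[of s T a b i] by (auto simp: descends_def inv_count_eq)
next
  case False
  have st: "s_tree s T" "vertices T = {1..n}" using T by (auto simp: s_decreasing_tree_iff)
  have "\<not> in_child T b i a"
  proof
    assume "in_child T b i a"
    then show False using in_child_vertices[of T b i a] in_child_iff[OF st(1), of a b i] st(2) False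
      by auto
  qed
  then show ?thesis using False by (auto simp: descends_def)
qed

lemma tree_ascent_iff:
  assumes T: "s_decreasing_tree n s T"
  shows "tree_ascent n s T a b \<longleftrightarrow> fun_ascent n s (inv_count n s T) a b"
proof (cases "1 \<le> a \<and> a < b \<and> b \<le> n")
  case True
  have st: "s_tree s T" "a \<in> vertices T" using T True by (auto simp: s_decreasing_tree_iff)
  have pos: "1 \<le> x" if "0 < s a" "inv_count n s T a x = s a" for x
    using that by (auto simp: inv_count_eq split: if_splits)
  have "(0 < s a \<longrightarrow> child_subtree T a (s a) Leaf) \<longleftrightarrow>
      (0 < s a \<longrightarrow> (\<forall>x. descends (inv_count n s T) a x \<longrightarrow> inv_count n s T a x \<noteq> s a))"
    unfolding child_subtree_Leaf_iff[OF st] in_child_iff_descends[OF T] using True pos by auto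
  moreover have "(\<forall>e j. a < e \<and> e < b \<and> in_child T e j a \<longrightarrow> j = s e) \<longleftrightarrow>
      (\<forall>e. a < e \<and> e < b \<and> descends (inv_count n s T) e a \<longrightarrow> inv_count n s T e a = s e)"
    unfolding in_child_iff_descends[OF T] using True by auto
  moreover have "(\<exists>i<s b. in_child T b i a) \<longleftrightarrow>
      descends (inv_count n s T) b a \<and> inv_count n s T b a < s b"
    unfolding in_child_iff_descends[OF T] using True by auto
  ultimately show ?thesis using True unfolding tree_ascent_def fun_ascent_def by blast
qed (auto simp: tree_ascent_def fun_ascent_def descends_def)

text \<open>The multiset with multiplicities \<open>tc_fun\<close> is transitive, contains
  \<open>I\<close> and lies below every transitive multiset containing \<open>I\<close>;
  antisymmetry then identifies it with the definite description.\<close>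

lemma count_inv_tc:
  assumes B: "bounded_fun n s (\<lambda>y x. count I (y, x))"
  shows "count (inv_tc n I) (y, x) = tc_fun (\<lambda>y x. count I (y, x)) y x"
proof -
  let ?m = "\<lambda>y x. count I (y, x)"
  define J where "J = (\<Sum>(y, x)\<in>inv_pairs n. replicate_mset (tc_fun ?m y x) (y, x))"
  have supp: "(y, x) \<in> inv_pairs n" if "tc_fun ?m y x \<noteq> 0" for y x
    using tc_fun_bounded[OF B] that unfolding bounded_fun_def inv_pairs_def by blast
  have J: "count J (y, x) = tc_fun ?m y x" for y x
    unfolding J_def count_sum_replicate[OF finite_inv_pairs] using supp by auto
  have trans: "inv_transitive K \<longleftrightarrow> transitive_fun (\<lambda>y x. count K (y, x))" for K
  proof -
    have "count K (b, a) = 0 \<or> count K (c, b) \<le> count K (c, a) \<longleftrightarrow>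
        (0 < count K (b, a) \<longrightarrow> count K (c, b) \<le> count K (c, a))" for a b c
      by linarith
    then show ?thesis unfolding inv_transitive_def transitive_fun_def by (simp only: imp_conjL)
  qed
  have "multi_inv_set n J"
    unfolding multi_inv_set_def
  proof
    fix p :: "nat \<times> nat" assume p: "p \<in># J"
    obtain y x where "p = (y, x)" by fastforce
    moreover have "count J p \<noteq> 0" using p by (simp add: count_eq_zero_iff)
    ultimately show "p \<in> inv_pairs n" using J supp by simp
  qed
  moreover have "inv_transitive J" unfolding trans J by (rule tc_fun_transitive)
  moreover have "I \<subseteq># J"
  proof (rule mset_subset_eqI)
    fix p :: "nat \<times> nat" obtain y x where p: "p = (y, x)" by fastforce
    have "count I (y, x) \<noteq> 0 \<Longrightarrow> x < y" using B unfolding bounded_fun_def by blast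
    then show "count I p \<le> count J p" using tc_fun_ge[of x y ?m] J p by (cases "count I p = 0") auto
  qed
  moreover have "J \<subseteq># K" if "inv_transitive K" "I \<subseteq># K" for K
  proof (rule mset_subset_eqI)
    fix p :: "nat \<times> nat" obtain y x where p: "p = (y, x)" by fastforce
    show "count J p \<le> count K p"
      unfolding p J using tc_fun_least[of "\<lambda>y x. count K (y, x)" ?m y x] that trans
      by (auto intro: mset_subset_eq_count)
  qed
  ultimately have "inv_tc n I = J"
    unfolding inv_tc_def by (intro the_equality) (blast intro: subset_mset.antisym)+
  then show ?thesis by (simp add: J)
qed

lemma is_rotation_iff:
  assumes T: "s_decreasing_tree n s T"
  shows "is_rotation n s T a b Z \<longleftrightarrow> fun_ascent n s (inv_count n s T) a b \<and> s_decreasing_tree n s Z \<and>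
    inv_count n s Z = rotate_fun (inv_count n s T) a b"
proof (cases "fun_ascent n s (inv_count n s T) a b")
  case True
  let ?I = "inv_plus s (tree_inv n s T) {#(b, a)#}"
  note f = inv_fun_inv_count[OF T]
  \<comment> \<open>The cap at \<open>s y\<close> has no effect: at an ascent
    \<open>f b a < s b\<close>, and all other entries are unchanged.\<close>
  have "count ?I (y, x) = add_pair (inv_count n s T) a b y x" for y x
  proof -
    have "count (tree_inv n s T) (y, x) = inv_count n s T y x" by (simp add: inv_count_def)
    moreover have "(y, x) \<in># tree_inv n s T \<longleftrightarrow> inv_count n s T y x \<noteq> 0"
      by (simp add: inv_count_def count_eq_zero_iff)
    ultimately show ?thesis
      unfolding inv_plus_def
      using True inv_fun_le[OF f, of y x]
      by (subst count_sum_replicate) (auto simp: add_pair_def fun_ascent_def)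
  qed
  then have I: "(\<lambda>y x. count ?I (y, x)) = add_pair (inv_count n s T) a b" by (simp add: fun_eq_iff)
  then have "bounded_fun n s (\<lambda>y x. count ?I (y, x))" using add_pair_bounded[OF f True] by simp
  from count_inv_tc[OF this] I
  have "(\<lambda>y x. count (inv_tc n ?I) (y, x)) = rotate_fun (inv_count n s T) a b"
    by (simp add: fun_eq_iff rotate_fun_def)
  then show ?thesis
    using True by (simp add: is_rotation_def tree_ascent_iff[OF T] tree_inv_eq_iff)
qed (simp add: is_rotation_def tree_ascent_iff[OF T])

subsection \<open>Cover relations\<close>

lemma carrier_s_weak_order: "T \<in> carrier (s_weak_order n s) \<longleftrightarrow> s_decreasing_tree n s T"
  by (simp add: s_weak_order_def)

lemma le_s_weak_order: "T \<sqsubseteq>\<^bsub>s_weak_order n s\<^esub> Z \<longleftrightarrow> inv_count n s T \<le> inv_count n s Z"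
  by (simp add: s_weak_order_def tree_inv_subseteq_iff)

lemma less_s_weak_order:
  "T \<sqsubset>\<^bsub>s_weak_order n s\<^esub> Z \<longleftrightarrow> inv_count n s T \<le> inv_count n s Z \<and> T \<noteq> Z"
  by (simp add: lless_def le_s_weak_order) (simp add: s_weak_order_def)

text \<open>An ascent whose entry grows towards \<open>Z\<close> has a rotation lying strictly above
  \<open>T\<close> and below \<open>Z\<close>, so this rotation is \<open>Z\<close>. Uniqueness of
  the pair evaluates the description in \<open>ascent_label\<close>.\<close>

lemma cover_rotation:
  assumes "covers (s_weak_order n s) T Z"
  obtains a b where "fun_ascent n s (inv_count n s T) a b"
    "inv_count n s Z = rotate_fun (inv_count n s T) a b" "ascent_label n s T Z = a"
proof -
  have T: "s_decreasing_tree n s T" and Z: "s_decreasing_tree n s Z"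
    and le: "inv_count n s T \<le> inv_count n s Z" and ne: "T \<noteq> Z"
    and between: "\<And>W. s_decreasing_tree n s W \<Longrightarrow> inv_count n s T \<le> inv_count n s W \<Longrightarrow> T \<noteq> W \<Longrightarrow>
      inv_count n s W \<le> inv_count n s Z \<Longrightarrow> W = Z"
    using assms by (auto simp: covers_def carrier_s_weak_order less_s_weak_order)
  note f = inv_fun_inv_count[OF T] and g = inv_fun_inv_count[OF Z]
  obtain a b where ab: "fun_ascent n s (inv_count n s T) a b" "inv_count n s T b a < inv_count n s Z b a"
    using exists_ascent_below[OF f g le] inv_count_inj[OF T Z] ne by metis
  obtain W where W: "s_decreasing_tree n s W" "inv_count n s W = rotate_fun (inv_count n s T) a b"
    using inv_fun_tree[OF rotate_fun_inv_fun[OF f ab(1)]] by blast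
  have "a < b" using ab(1) by (simp add: fun_ascent_def descends_def)
  then have "T \<noteq> W" using rotate_fun_increases[of a b "inv_count n s T"] W by auto
  moreover have "inv_count n s W \<le> inv_count n s Z"
    unfolding W using g le ab by (intro rotate_fun_least) (auto simp: inv_fun_def)
  ultimately have "W = Z" using between W rotate_fun_ge[OF f, of a b] by simp
  then have rot: "is_rotation n s T a b Z" using is_rotation_iff[OF T] ab W by simp
  have uniq: "a' = a \<and> b' = b" if "is_rotation n s T a' b' Z" for a' b'
    using that rot rotate_fun_unique[OF f, of a' b' a b] unfolding is_rotation_iff[OF T] by simp
  have "(THE (a, b). is_rotation n s T a b Z) = (a, b)"
  proof (rule the_equality)
    fix p assume "case p of (a', b') \<Rightarrow> is_rotation n s T a' b' Z"
    then show "p = (a, b)" using uniq by (cases p) simp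
  qed (use rot in simp)
  then have "ascent_label n s T Z = a" by (simp add: ascent_label_def)
  then show ?thesis using that rot[unfolded is_rotation_iff[OF T]] by blast
qed

lemma cover_label_inj:
  assumes "covers (s_weak_order n s) u v" "covers (s_weak_order n s) u w"
    and "ascent_label n s u v = ascent_label n s u w"
  shows "v = w"
proof -
  obtain a b where v: "fun_ascent n s (inv_count n s u) a b"
    "inv_count n s v = rotate_fun (inv_count n s u) a b" "ascent_label n s u v = a"
    using cover_rotation[OF assms(1)] .
  obtain a' b' where w: "fun_ascent n s (inv_count n s u) a' b'"
    "inv_count n s w = rotate_fun (inv_count n s u) a' b'" "ascent_label n s u w = a'"
    using cover_rotation[OF assms(2)] .
  have "inv_count n s v = inv_count n s w"
    using v w assms(3) fun_ascent_unique[of n s "inv_count n s u" a b b'] by simp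
  then show ?thesis
    using inv_count_inj assms(1,2) by (auto simp: covers_def carrier_s_weak_order)
qed

lemma cover_le_cover:
  assumes "covers (s_weak_order n s) u v" "covers (s_weak_order n s) u w"
    and "inv_count n s w \<le> inv_count n s v"
  shows "w = v"
  using assms unfolding covers_def less_s_weak_order by blast

subsection \<open>The lattice and the labeling\<close>

lemma finite_s_weak_order: "finite (carrier (s_weak_order n s))"
proof -
  \<comment> \<open>The sum of all \<open>s y\<close> serves as one common bound for every
    multiplicity, so trees embed into a finite set of functions.\<close>
  let ?G = "{g :: nat \<times> nat \<Rightarrow> nat.
    \<forall>p. (p \<in> inv_pairs n \<longrightarrow> g p \<in> {..\<Sum>y\<le>n. s y}) \<and> (p \<notin> inv_pairs n \<longrightarrow> g p = 0)}"
  let ?h = "\<lambda>T. count (tree_inv n s T)"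
  have "?h T \<in> ?G" if "T \<in> carrier (s_weak_order n s)" for T
  proof -
    have f: "inv_fun n s (inv_count n s T)"
      using that inv_fun_inv_count by (simp add: carrier_s_weak_order)
    have "?h T p \<le> (\<Sum>y\<le>n. s y)" if "p \<in> inv_pairs n" for p
    proof -
      have p: "fst p \<le> n" using that by (auto simp: inv_pairs_def)
      have "?h T p \<le> s (fst p)" using inv_fun_le[OF f, of "fst p" "snd p"] by (simp add: inv_count_def)
      also have "\<dots> \<le> (\<Sum>y\<le>n. s y)" using p by (intro member_le_sum) auto
      finally show ?thesis .
    qed
    moreover have "?h T p = 0" if "p \<notin> inv_pairs n" for p
      using inv_fun_supp[OF f, of "fst p" "snd p"] that
      by (cases p) (auto simp: inv_count_def inv_pairs_def count_eq_zero_iff)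
    ultimately show ?thesis by auto
  qed
  then have "?h ` carrier (s_weak_order n s) \<subseteq> ?G" by (rule image_subsetI)
  moreover have "finite ?G" by (rule finite_set_of_finite_funs[OF finite_inv_pairs]) simp
  moreover have "inj_on ?h (carrier (s_weak_order n s))"
    using inv_count_inj by (intro inj_onI) (auto simp: carrier_s_weak_order inv_count_def fun_eq_iff)
  ultimately show ?thesis using finite_subset finite_imageD by blast
qed

lemma partial_order_s_weak_order: "partial_order (s_weak_order n s)"
proof -
  have eq: "(.=\<^bsub>s_weak_order n s\<^esub>) = (=)" by (simp add: s_weak_order_def)
  show ?thesis
  proof
    show "(.=\<^bsub>s_weak_order n s\<^esub>) = (=)" by (rule eq)
  qed (auto simp: eq le_s_weak_order carrier_s_weak_order intro: inv_count_inj order_trans)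
qed

lemma lattice_s_weak_order: "lattice (s_weak_order n s)"
proof -
  let ?L = "s_weak_order n s"
  interpret partial_order ?L by (rule partial_order_s_weak_order)
  have join: "\<exists>j. least ?L j (Upper ?L X)" if X: "X \<subseteq> carrier ?L" for X
  proof -
    have F: "inv_fun n s k" if "k \<in> inv_count n s ` X" for k
      using that X inv_fun_inv_count by (auto simp: carrier_s_weak_order subset_iff)
    obtain h where h: "inv_fun n s h" "\<forall>k\<in>inv_count n s ` X. k \<le> h"
      "\<forall>k. inv_fun n s k \<longrightarrow> (\<forall>i\<in>inv_count n s ` X. i \<le> k) \<longrightarrow> h \<le> k"
      using inv_fun_lub[OF F] by blast
    obtain j where j: "s_decreasing_tree n s j" "inv_count n s j = h" using inv_fun_tree[OF h(1)] .
    have "least ?L j (Upper ?L X)"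
    proof (rule least_UpperI)
      show "x \<sqsubseteq>\<^bsub>?L\<^esub> j" if "x \<in> X" for x using h(2) that j by (simp add: le_s_weak_order)
      show "j \<sqsubseteq>\<^bsub>?L\<^esub> y" if "y \<in> Upper ?L X" for y
      proof -
        have y: "s_decreasing_tree n s y" "\<And>x. x \<in> X \<Longrightarrow> inv_count n s x \<le> inv_count n s y"
          using that X unfolding Upper_def by (auto simp: carrier_s_weak_order le_s_weak_order)
        then show ?thesis using h(3)[rule_format, of "inv_count n s y"] inv_fun_inv_count j
          by (auto simp: le_s_weak_order)
      qed
    qed (use X j in \<open>auto simp: carrier_s_weak_order\<close>)
    then show ?thesis ..
  qed
  \<comment> \<open>A meet is obtained as the join of all common lower bounds.\<close>
  have "\<exists>m. greatest ?L m (Lower ?L {x, y})" if xy: "x \<in> carrier ?L" "y \<in> carrier ?L" for x y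
  proof -
    obtain m where m: "least ?L m (Upper ?L (Lower ?L {x, y}))"
      using join[of "Lower ?L {x, y}"] by auto
    then have mc: "m \<in> carrier ?L" by (simp add: least_def Upper_def)
    have "m \<sqsubseteq>\<^bsub>?L\<^esub> z" if "z \<in> {x, y}" for z
      using that xy by (intro least_le[OF m]) (auto simp: Upper_def Lower_def)
    then have "greatest ?L m (Lower ?L {x, y})"
      using xy mc least_Upper_above[OF m] by (intro greatest_LowerI) auto
    then show ?thesis ..
  qed
  then show ?thesis by unfold_locales (auto intro: join)
qed

text \<open>The assumptions on \<open>j\<close> say that it is the join of \<open>v\<close> and
  \<open>w\<close>. They are symmetric, so the order of the two labels can be fixed here and
  exchanged in the final theorem.\<close>

lemma saturated_chain_labels:
  assumes uv: "covers (s_weak_order n s) u v" and uw: "covers (s_weak_order n s) u w"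
    and less: "ascent_label n s u w < ascent_label n s u v"
    and j: "inv_count n s v \<le> inv_count n s j" "inv_count n s w \<le> inv_count n s j"
      "\<And>k. s_decreasing_tree n s k \<Longrightarrow> inv_count n s v \<le> inv_count n s k \<Longrightarrow>
        inv_count n s w \<le> inv_count n s k \<Longrightarrow> inv_count n s j \<le> inv_count n s k"
    and c: "saturated_chain (s_weak_order n s) u j c"
  shows "set (chain_labels (ascent_label n s) c) = {ascent_label n s u v, ascent_label n s u w}"
proof -
  let ?L = "s_weak_order n s" and ?f = "inv_count n s u"
  define lab where "lab i = ascent_label n s (c ! i) (c ! Suc i)" for i
  define F where "F i = inv_count n s (c ! i)" for i
  obtain a b where v: "fun_ascent n s ?f a b" "inv_count n s v = rotate_fun ?f a b"
    "ascent_label n s u v = a"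
    using cover_rotation[OF uv] .
  obtain a' b' where w: "fun_ascent n s ?f a' b'" "inv_count n s w = rotate_fun ?f a' b'"
    "ascent_label n s u w = a'"
    using cover_rotation[OF uw] .
  have u: "s_decreasing_tree n s u" using uv by (simp add: covers_def carrier_s_weak_order)
  note f = inv_fun_inv_count[OF u]
  have "a' < a" using less v w by simp
  then interpret two_ascents n s ?f a b a' b' using f v w by unfold_locales
  have bound: "inv_count n s j y x \<le> ?f y x + of_bool (join_changes ?f a b a' b' y x)" for y x
  proof (rule join_le)
    fix k assume k: "inv_fun n s k" "rotate_fun ?f a b \<le> k" "rotate_fun ?f a' b' \<le> k"
    obtain K where "s_decreasing_tree n s K" "inv_count n s K = k" using inv_fun_tree[OF k(1)] .
    then show "inv_count n s j \<le> k" using j(3)[of K] k v w by simp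
  qed
  have c0: "c \<noteq> []" "c ! 0 = u" "c ! (length c - 1) = j"
    using c by (auto simp: saturated_chain_def hd_conv_nth last_conv_nth)
  have dec: "s_decreasing_tree n s (c ! i)" if "i < length c" for i
    using c nth_mem[OF that] carrier_s_weak_order unfolding saturated_chain_def by blast
  have cov: "covers ?L (c ! i) (c ! Suc i)" if "Suc i < length c" for i
    using c that by (auto simp: saturated_chain_def successively_conv_nth)
  have F0: "F 0 = ?f" "F (length c - 1) = inv_count n s j" by (simp_all only: F_def c0)
  have mono: "F i \<le> F k" if "i \<le> k" "k < length c" for i k
    using that
  proof (induction rule: dec_induct)
    case (step k)
    have "F k \<le> F (Suc k)"
      using cov[of k] step.prems by (auto simp: F_def covers_def less_s_weak_order)
    then show ?case using step by (meson Suc_lessD order_trans)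
  qed simp
  have rot: "\<exists>y. fun_ascent n s (F i) (lab i) y \<and> F (Suc i) = rotate_fun (F i) (lab i) y"
    if "Suc i < length c" for i
    using cover_rotation[OF cov[OF that]] unfolding F_def lab_def by metis
  have labels: "set (chain_labels (ascent_label n s) c) = lab ` {i. Suc i < length c}"
    unfolding chain_labels_def lab_def by (force simp: set_zip nth_tl)
  have in_interval: "lab i = a \<or> lab i = a'" if i: "Suc i < length c" for i
  proof -
    obtain y where y: "fun_ascent n s (F i) (lab i) y" "F (Suc i) = rotate_fun (F i) (lab i) y"
      using rot[OF i] by blast
    have "F (Suc i) \<le> inv_count n s j" "?f \<le> F i"
      using mono[of "Suc i" "length c - 1"] mono[of 0 i] i F0 by auto
    then show ?thesis
      using label_in_interval[OF bound _ _ y(1)] y(2) inv_fun_inv_count[OF dec[of i]] i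
      by (simp add: F_def)
  qed
  have "\<exists>i. Suc i < length c \<and> lab i = a"
  proof (rule ccontr)
    assume none: "\<nexists>i. Suc i < length c \<and> lab i = a"
    \<comment> \<open>A step labeled \<open>a'\<close> changes only columns up to \<open>a'\<close>,
      which is less than \<open>a\<close>, so the entry at \<open>(b, a)\<close> would never reach
      its value in \<open>j\<close>.\<close>
    have "F i b a = ?f b a" if "i < length c" for i
      using that
    proof (induction i)
      case (Suc i)
      then have "lab i = a'" using in_interval none by blast
      then obtain y where "fun_ascent n s (F i) a' y" "F (Suc i) = rotate_fun (F i) a' y"
        using rot[OF Suc.prems] by auto
      moreover have "inv_fun n s (F i)" using inv_fun_inv_count[OF dec[of i]] Suc.prems by (simp add: F_def)
      ultimately have "F (Suc i) b a = F i b a"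
        using rotate_fun_changes[of n s "F i" a' y b a] \<open>a' < a\<close> by fastforce
      then show ?case using Suc by simp
    qed (simp add: F0)
    then have "inv_count n s j b a = ?f b a" using F0 c0(1) by (metis diff_less length_greater_0_conv zero_less_one)
    moreover have "?f b a < inv_count n s v b a" using rotate_fun_increases[of a b ?f] a_less_b v by simp
    moreover have "inv_count n s v b a \<le> inv_count n s j b a" using j(1) by (simp add: le_fun_def)
    ultimately show False by simp
  qed
  moreover have "\<exists>i. Suc i < length c \<and> lab i = a'"
  proof (rule ccontr)
    assume "\<nexists>i. Suc i < length c \<and> lab i = a'"
    then have all: "lab i = a" if "Suc i < length c" for i using in_interval that by blast
    have wne: "w \<noteq> v" using v(3) w(3) \<open>a' < a\<close> by auto
    have len: "1 < length c"
    proof (rule ccontr)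
      assume "\<not> 1 < length c"
      then have "inv_count n s v \<le> ?f" using F0 c0(1) j(1) by (cases c) auto
      then show False using uv unfolding covers_def less_s_weak_order carrier_s_weak_order
        using inv_count_inj[of n s u v] order_antisym by blast
    qed
    \<comment> \<open>A label determines the cover, so a chain with all labels \<open>a\<close> must
      start with the step from \<open>u\<close> to \<open>v\<close>.\<close>
    have "c ! 1 = v"
      using cover_label_inj[of n s u "c ! 1" v] cov[of 0] all[of 0] len c0 uv v(3) by (simp add: lab_def)
    then have F1: "F 1 = rotate_fun ?f a b" using v by (simp add: F_def)
    show False
    proof (cases "length c = 2")
      case True
      then have "j = v" using c0 \<open>c ! 1 = v\<close> by simp
      then show False using cover_le_cover[OF uv uw] j(2) wne by simp
    next
      case False
      then have two: "2 < length c" using len by simp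
      then obtain y where y: "fun_ascent n s (F 1) a y" "F 2 = rotate_fun (F 1) a y"
        using rot[of 1] all[of 1] by (auto simp: numeral_2_eq_2)
      have "a < y" using y by (simp add: fun_ascent_def descends_def)
      then have "F 1 y a < F 2 y a" using y rotate_fun_increases by simp
      also have "F 2 y a \<le> inv_count n s j y a"
        using mono[of 2 "length c - 1"] two F0 by (simp add: le_fun_def)
      also have "\<dots> \<le> ?f y a + of_bool (join_changes ?f a b a' b' y a)" by (rule bound)
      finally have lt: "F 1 y a < ?f y a + of_bool (join_changes ?f a b a' b' y a)" .
      moreover have "?f y a \<le> F 1 y a" using mono[of 0 1] len F0 by (simp add: le_fun_def)
      ultimately have "join_changes ?f a b a' b' y a"
        by (cases "join_changes ?f a b a' b' y a") auto
      \<comment> \<open>As \<open>a\<close> exceeds every vertex carried by \<open>a'\<close>, a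
        change at \<open>(y, a)\<close> is possible only in row \<open>b\<close>. There the first
        rotation has already used up the single unit that the bound allows.\<close>
      then have "y = b" using carried_le[of a ?f a'] \<open>a' < a\<close> by (auto simp: join_changes_def)
      then show False using lt F1 rotate_fun_increases[of a b ?f] a_less_b
        by (cases "join_changes ?f a b a' b' y a") auto
    qed
  qed
  ultimately show ?thesis unfolding labels v(3) w(3) using in_interval by blast
qed

theorem theorem3p20:
  fixes n :: nat and s :: "nat \<Rightarrow> nat"
  shows "SB_labeling (s_weak_order n s) (ascent_label n s)"
proof -
  let ?L = "s_weak_order n s" and ?lab = "ascent_label n s"
  interpret lattice ?L by (rule lattice_s_weak_order)
  have main: "?lab u v \<noteq> ?lab u w \<and> (\<forall>c. saturated_chain ?L u (v \<squnion>\<^bsub>?L\<^esub> w) c \<longrightarrow>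
      set (chain_labels ?lab c) = {?lab u v, ?lab u w})"
    if uv: "covers ?L u v" and uw: "covers ?L u w" and ne: "v \<noteq> w" for u v w
  proof (intro conjI allI impI)
    show labs: "?lab u v \<noteq> ?lab u w" using cover_label_inj[OF uv uw] ne by blast
    fix c assume c: "saturated_chain ?L u (v \<squnion>\<^bsub>?L\<^esub> w) c"
    have car: "v \<in> carrier ?L" "w \<in> carrier ?L" using uv uw by (auto simp: covers_def)
    note up = join_left[OF car] join_right[OF car]
    note least = join_le[OF _ _ car]
    note simps = le_s_weak_order carrier_s_weak_order
    consider "?lab u w < ?lab u v" | "?lab u v < ?lab u w" using labs by linarith
    then show "set (chain_labels ?lab c) = {?lab u v, ?lab u w}"
    proof cases
      case 1
      show ?thesis
        by (rule saturated_chain_labels[OF uv uw 1 _ _ _ c]) (use up least in \<open>auto simp: simps\<close>)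
    next
      case 2
      have "set (chain_labels ?lab c) = {?lab u w, ?lab u v}"
        by (rule saturated_chain_labels[OF uw uv 2 _ _ _ c]) (use up least in \<open>auto simp: simps\<close>)
      then show ?thesis by auto
    qed
  qed
  show ?thesis
    unfolding SB_labeling_def
    using main lattice_s_weak_order finite_s_weak_order by (metis insertI1 insertI2 subset_refl)
qed

end
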